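(* Let $q\in(0,1)$ and $\nu>-1$. Then the radius of starlikeness $r^*\left(g_{\nu}^{(3)}(\cdot;q)\right)$ of the function $$z\mapsto g_{\nu}^{(3)}(z;q)=c_{\nu}(q)z^{1-\nu}J_{\nu}^{(3)}(z;q)$$ is the smallest positive root of the equation $r\cdot \frac{d}{dr}J_{\nu}^{(3)}(r;q)-(\nu-1)J_{\nu}^{(3)}(r;q)=0$ and satisfies $$\sqrt{\frac{(1-q)(1-q^{\nu+1})}{3q}}<r^*\left(g_{\nu}^{(3)}(\cdot;q)\right)<\sqrt{\frac{3(q^{\nu+1}-1)(q^{\nu+2}-1)(q^2-1)}{q(9q^{\nu+3}-q^{\nu+2}+q-9)}}$$ and $$\sqrt[4]{\frac{(q^{\nu+1}-1)^2(q-1)^2(q^{\nu+2}-1)(q+1)}{q^2(9q^{\nu+3}-q^{\nu+2}+q-9)}}<r^*\left(g_{\nu}^{(3)}(\cdot;q)\right)< \sqrt{\frac{(q-1)(q^{\nu+1}-1)(q^{\nu+3}-1)}{3q(q+1)}\,q_3^*(\nu)},$$ where $$q_3^*(\nu)=\frac{(9q^{\nu+3}-q^{\nu+2}+q-9)(q^3+2q^2+2q+1)}{s_{\nu}(q)+r_{\nu}(q)},$$ $$s_{\nu}(q)=6q^{\nu+2}-12q^{\nu+3}-20q^{\nu+4}-12q^{\nu+5}+6q^{\nu+6}+q^{2\nu+5},$$ $$r_{\nu}(q)=3q^{2\nu+6}+3q^{2\nu+7}+9q^{2\nu+8}+q^3+3q^2+3q+9.$$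
   Context: For $a\in\mathbb{C}$ and $q\in(0,1)$: $(a;q)_0=1$, $(a;q)_n=\prod_{k=1}^{n}(1-aq^{k-1})$, $(a;q)_\infty=\prod_{k\geq1}(1-aq^{k-1})$. The Hahn–Exton $q$-Bessel function is, for $\nu>-1$, $$J_{\nu}^{(3)}(z;q)=\frac{(q^{\nu+1};q)_{\infty}}{(q;q)_{\infty}}\sum_{n\geq0}\frac{(-1)^{n}z^{2n+\nu}}{(q;q)_{n}(q^{\nu+1};q)_{n}}q^{\frac{1}{2}n(n+1)},$$ and $c_{\nu}(q)=(q;q)_{\infty}/(q^{\nu+1};q)_{\infty}$; thus $g_\nu^{(3)}(\cdot;q)$ is entire with $g(0)=0$, $g'(0)=1$. For such $f$, the radius of starlikeness is $r^*(f)=\sup\{r>0:\ \mathrm{Re}\,(zf'(z)/f(z))>0 \text{ for all } |z|<r\}$. *)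

theory Defs
  imports "HOL-Analysis.Analysis"
begin

definition qpoch :: "'a::real_normed_field \<Rightarrow> 'a \<Rightarrow> nat \<Rightarrow> 'a" where
  "qpoch a q n = (\<Prod>k<n. 1 - a * q ^ k)"

definition qpoch_inf :: "real \<Rightarrow> real \<Rightarrow> real" where
  "qpoch_inf a q = (\<Prod>k. 1 - a * q ^ k)"

text \<open>Hahn--Exton q-Bessel function on the positive real axis (r > 0),
  with z^(2n+nu) = r powr (2n+nu).\<close>
definition J3 :: "real \<Rightarrow> real \<Rightarrow> real \<Rightarrow> real" where
  "J3 \<nu> q r = qpoch_inf (q powr (\<nu> + 1)) q / qpoch_inf q q *
     (\<Sum>n. (-1) ^ n * r powr (2 * real n + \<nu>) * q powr (real n * (real n + 1) / 2)
        / (qpoch q q n * qpoch (q powr (\<nu> + 1)) q n))"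

definition c_nu :: "real \<Rightarrow> real \<Rightarrow> real" where
  "c_nu \<nu> q = qpoch_inf q q / qpoch_inf (q powr (\<nu> + 1)) q"

text \<open>g_nu(z) = c_nu(q) z^(1-nu) J_nu(z;q); the factor z^(1-nu) z^(2n+nu) = z^(2n+1)
  is combined termwise, giving the entire function of the paper.\<close>
definition g3 :: "real \<Rightarrow> real \<Rightarrow> complex \<Rightarrow> complex" where
  "g3 \<nu> q z = complex_of_real (c_nu \<nu> q) *
     complex_of_real (qpoch_inf (q powr (\<nu> + 1)) q / qpoch_inf q q) *
     (\<Sum>n. (-1) ^ n * z ^ (2 * n + 1) * complex_of_real (q powr (real n * (real n + 1) / 2))
        / complex_of_real (qpoch q q n * qpoch (q powr (\<nu> + 1)) q n))"

text \<open>Radius of starlikeness. At z = 0 the quotient z f'(z)/f(z) is understood as its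
  limit 1 (f(0)=0, f'(0)=1), so only z with 0 < |z| < r are tested.\<close>
definition radius_starlike :: "(complex \<Rightarrow> complex) \<Rightarrow> real" where
  "radius_starlike f = Sup {r. r > 0 \<and>
     (\<forall>z. 0 < norm z \<and> norm z < r \<longrightarrow> Re (z * deriv f z / f z) > 0)}"

end

theory Submission
  imports Defs "HOL-Computational_Algebra.Polynomial_FPS"
begin

text \<open>
  Write \<open>g(z) = z F(z\<^sup>2)\<close> and \<open>a = q powr (\<nu> + 1)\<close>. Then \<open>g'(z) = H(z\<^sup>2)\<close> with \<open>H = F + 2 w F'\<close>, and
  \<open>r J'(r) - (\<nu> - 1) J(r)\<close> is a nonzero multiple of \<open>r powr \<nu> * H(r\<^sup>2)\<close>. Instead of a Hadamard
  factorisation, \<open>F\<close> is obtained as a coefficientwise limit of polynomials with positive zeros: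
  starting from \<open>(q w; q)\<^sub>N\<close>, each operator \<open>p(w) \<mapsto> p(w) - c p(q w)\<close> with \<open>0 < c < 1\<close> preserves
  positive zeros whose consecutive ratios are at least \<open>1 / q\<close>. By Rolle's theorem \<open>H\<close> is such a
  limit, too.

  For a polynomial with positive zeros, the real part of the logarithmic derivative on a circle is
  smallest on the positive axis, so in the limit \<open>Re (z g' / g) \<ge> H(|z|\<^sup>2) / F(|z|\<^sup>2)\<close>, and the
  radius of starlikeness is the square root of the smallest zero \<open>w\<close> of \<open>H\<close>. The bounds are the
  Euler--Rayleigh inequalities \<open>S\<^sub>k powr (-1 / k) < w < S\<^sub>k / S\<^sub>k\<^sub>+\<^sub>1\<close> for the power sums \<open>S\<^sub>k\<close> of
  the reciprocal zeros, given by Newton's identities. Strictness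
  survives the limit: equality would make \<open>H' / H\<close> rational, which the superexponential decay of
  the coefficients excludes.
\<close>

section \<open>Polynomials with positive zeros\<close>

definition root_poly :: "nat \<Rightarrow> (nat \<Rightarrow> real) \<Rightarrow> real poly" where
  "root_poly N t = (\<Prod>i<N. [:1, - t i:])"

lemma poly_root_poly: "poly (root_poly N t) w = (\<Prod>i<N. 1 - t i * w)"
  by (simp add: root_poly_def poly_prod mult.commute)

lemma degree_root_poly_le: "degree (root_poly N t) \<le> N"
proof -
  have "degree (root_poly N t) \<le> (\<Sum>i<N. degree [:1, - t i:])"
    unfolding root_poly_def by (rule order.trans[OF degree_prod_sum_le]) auto
  also have "\<dots> \<le> (\<Sum>i<N. 1)"
    by (intro sum_mono) auto
  finally show ?thesis by simp
qed

lemma coeff_root_poly_0: "coeff (root_poly N t) 0 = 1"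
  by (simp add: poly_root_poly flip: poly_0_coeff_0)

lemma poly_eq_root_poly:
  fixes p :: "real poly"
  assumes deg: "degree p \<le> N" and p0: "coeff p 0 = 1"
    and inj: "inj_on x {..<N}" and root: "\<And>i. i < N \<Longrightarrow> x i \<noteq> 0 \<and> poly p (x i) = 0"
  shows "p = root_poly N (\<lambda>i. 1 / x i)"
proof (rule poly_eqI_degree)
  have "0 \<notin> x ` {..<N}"
    using root by auto
  then have "card (insert 0 (x ` {..<N})) = Suc N"
    using inj by (simp add: card_image)
  then show "card (insert 0 (x ` {..<N})) > degree p"
    "card (insert 0 (x ` {..<N})) > degree (root_poly N (\<lambda>i. 1 / x i))"
    using deg degree_root_poly_le[of N "\<lambda>i. 1 / x i"] by simp_all
  fix w assume "w \<in> insert 0 (x ` {..<N})"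
  then consider "w = 0" | i where "i < N" "w = x i" by auto
  then show "poly p w = poly (root_poly N (\<lambda>i. 1 / x i)) w"
  proof cases
    case 1
    then show ?thesis using p0 by (simp add: poly_0_coeff_0 coeff_root_poly_0)
  next
    case 2
    then have "(\<Prod>j<N. 1 - 1 / x j * w) = 0"
      using root[of i] by (intro prod_zero) auto
    then show ?thesis using 2 root by (simp add: poly_root_poly)
  qed
qed

definition pos_increasing :: "nat \<Rightarrow> (nat \<Rightarrow> real) \<Rightarrow> bool" where
  "pos_increasing N x \<longleftrightarrow> (\<forall>i<N. 0 < x i) \<and> (\<forall>i. Suc i < N \<longrightarrow> x i < x (Suc i))"

lemma pos_increasing_less:
  assumes "pos_increasing N x" "i < j" "j < N"
  shows "x i < x j"
  using assms(2,3)
proof (induction j)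
  case (Suc j)
  have "x j < x (Suc j)"
    using assms(1) Suc.prems unfolding pos_increasing_def by blast
  then show ?case
    using Suc by (cases "i = j") auto
qed simp

lemma pos_increasing_inj_on: "pos_increasing N x \<Longrightarrow> inj_on x {..<N}"
  by (rule linorder_inj_onI') (use pos_increasing_less in fastforce)

lemma root_poly_sign:
  assumes x: "pos_increasing N x" and i: "i < N" and "0 \<le> w" "w \<le> x i"
    and low: "\<And>j. i = Suc j \<Longrightarrow> x j \<le> w"
  shows "0 \<le> (-1) ^ i * poly (root_poly N (\<lambda>i. 1 / x i)) w"
proof -
  have pos: "0 < x j" if "j < N" for j
    using x that unfolding pos_increasing_def by blast
  have le1: "x j \<le> w" if "j < i" for j
  proof (cases i)
    case (Suc k)
    then have "x j \<le> x k"
      using that i pos_increasing_less[OF x, of j k] by (cases "j = k") auto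
    with low[OF Suc] show ?thesis by simp
  qed (use that in simp)
  have le2: "w \<le> x j" if "i \<le> j" "j < N" for j
    using that pos_increasing_less[OF x, of i j] \<open>w \<le> x i\<close> by (cases "j = i") auto
  have "(\<Prod>j<N. 1 - 1 / x j * w) = (\<Prod>j<i. 1 - 1 / x j * w) * (\<Prod>j\<in>{i..<N}. 1 - 1 / x j * w)"
    using i by (subst prod.union_disjoint[symmetric]) (auto intro: prod.cong)
  moreover have "(-1) ^ i * (\<Prod>j<i. 1 - 1 / x j * w) = (\<Prod>j<i. 1 / x j * w - 1)"
    using prod.distrib[of "\<lambda>_. - 1 :: real" "\<lambda>j. 1 - 1 / x j * w" "{..<i}"] by simp
  moreover have "0 \<le> (\<Prod>j<i. 1 / x j * w - 1)"
    using le1 pos i by (intro prod_nonneg) (auto simp: field_simps)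
  moreover have "0 \<le> (\<Prod>j\<in>{i..<N}. 1 - 1 / x j * w)"
    using le2 pos by (intro prod_nonneg) (auto simp: field_simps)
  ultimately show ?thesis
    by (simp add: poly_root_poly mult.assoc[symmetric])
qed

definition q_separated :: "real \<Rightarrow> nat \<Rightarrow> (nat \<Rightarrow> real) \<Rightarrow> bool" where
  "q_separated q N x \<longleftrightarrow> (\<forall>i<N. 0 < x i) \<and> (\<forall>i. Suc i < N \<longrightarrow> x i \<le> q * x (Suc i))"

lemma q_separated_imp_pos_increasing:
  assumes "q_separated q N x" "q < 1"
  shows "pos_increasing N x"
  unfolding pos_increasing_def
proof (intro conjI allI impI)
  fix i assume i: "Suc i < N"
  then have "x i \<le> q * x (Suc i)" "0 < x (Suc i)"
    using assms(1) unfolding q_separated_def by auto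
  moreover from this have "q * x (Suc i) < 1 * x (Suc i)"
    using assms(2) by (intro mult_strict_right_mono) auto
  ultimately show "x i < x (Suc i)" by linarith
qed (use assms(1) in \<open>auto simp: q_separated_def\<close>)

lemma ivt_sign_change:
  fixes f :: "real \<Rightarrow> real"
  assumes "a \<le> b" "continuous_on {a..b} f" "0 \<le> s * f a" "s * f b \<le> 0" "s \<noteq> 0"
  shows "\<exists>y. a \<le> y \<and> y \<le> b \<and> f y = 0"
proof -
  have "continuous_on {a..b} (\<lambda>y. s * f y)"
    using assms(2) by (intro continuous_intros)
  from IVT2'[OF assms(4,3,1) this] show ?thesis using assms(5) by auto
qed

text \<open>On \<open>[x (i - 1) / q, x i]\<close> the sign of \<open>p(w) - c p(q w)\<close> changes: at the left end the second
  term vanishes, at the right end the first one does.\<close>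
lemma q_separated_step:
  fixes q c :: real
  assumes q: "0 < q" "q < 1" and c: "0 < c" "c < 1" and x: "q_separated q N x"
  defines "p \<equiv> root_poly N (\<lambda>i. 1 / x i)"
  shows "\<exists>y. q_separated q N y \<and>
    p - smult c (pcompose p [:0, q:]) = smult (1 - c) (root_poly N (\<lambda>i. 1 / y i))"
proof -
  have inc: "pos_increasing N x"
    by (rule q_separated_imp_pos_increasing[OF x q(2)])
  have pos: "0 < x i" if "i < N" for i
    using x that unfolding q_separated_def by blast
  have sep: "x i \<le> q * x (Suc i)" if "Suc i < N" for i
    using x that unfolding q_separated_def by blast
  define r where "r = p - smult c (pcompose p [:0, q:])"
  have r: "poly r w = poly p w - c * poly p (q * w)" for w
    by (simp add: r_def poly_pcompose mult.commute)
  define l where "l i = (case i of 0 \<Rightarrow> 0 | Suc j \<Rightarrow> x j / q)" for i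
  have p_root: "poly p (x i) = 0" if "i < N" for i
    using pos[OF that] that unfolding p_def poly_root_poly by (intro prod_zero bexI[of _ i]) auto
  have p_0: "poly p 0 = 1"
    by (simp add: p_def poly_root_poly)
  have l_le: "l i \<le> x i" if "i < N" for i
    using sep[of "i - 1"] pos[OF that] that q by (cases i) (auto simp: l_def field_simps)
  have l_nonneg: "0 \<le> l i" if "i < N" for i
    using pos[of "i - 1"] that q by (cases i) (auto simp: l_def less_imp_le)
  have "\<exists>y. l i \<le> y \<and> y \<le> x i \<and> poly r y = 0" if i: "i < N" for i
  proof (rule ivt_sign_change)
    show "0 \<le> (-1) ^ i * poly r (l i)"
    proof (cases i)
      case 0
      then show ?thesis using c by (simp add: l_def r p_0)
    next
      case (Suc j)
      have "x j \<le> x j / q"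
        using pos[of j] q i Suc by (simp add: field_simps)
      then have "0 \<le> (-1) ^ i * poly p (l i)"
        unfolding p_def using l_le[OF i] l_nonneg[OF i] Suc
        by (intro root_poly_sign[OF inc i]) (auto simp: l_def)
      moreover have "poly r (l i) = poly p (l i)"
        using q p_root[of j] i Suc by (simp add: r l_def)
      ultimately show ?thesis by simp
    qed
    have "0 \<le> (-1) ^ i * poly p (q * x i)"
      unfolding p_def using pos[OF i] q i sep
      by (intro root_poly_sign[OF inc i]) (auto simp: mult_le_cancel_right1)
    then have "0 \<le> c * ((-1) ^ i * poly p (q * x i))"
      using c by simp
    then show "(-1) ^ i * poly r (x i) \<le> 0"
      using p_root[OF i] by (simp add: r algebra_simps)
  qed (use l_le[OF i] in \<open>auto intro!: continuous_intros\<close>)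
  then obtain y where y: "\<And>i. i < N \<Longrightarrow> l i \<le> y i \<and> y i \<le> x i \<and> poly r (y i) = 0"
    by metis
  have y_pos: "0 < y i" if "i < N" for i
  proof (cases i)
    case 0
    have "poly r 0 \<noteq> 0" using c by (simp add: r p_0)
    then have "y i \<noteq> 0" using y[OF that] by auto
    then show ?thesis using y[OF that] 0 by (simp add: l_def)
  next
    case (Suc j)
    then have "0 < x j / q" using pos[of j] q that by simp
    then show ?thesis using y[OF that] Suc by (simp add: l_def)
  qed
  have y_sep: "q_separated q N y"
    unfolding q_separated_def
  proof (intro conjI allI impI)
    fix i assume "Suc i < N"
    then have "y i \<le> x i" "x i / q \<le> y (Suc i)"
      using y[of i] y[of "Suc i"] by (auto simp: l_def)
    then show "y i \<le> q * y (Suc i)" using q by (simp add: field_simps)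
  qed (use y_pos in auto)
  have "smult (1 / (1 - c)) r = root_poly N (\<lambda>i. 1 / y i)"
  proof (rule poly_eq_root_poly)
    have "degree p \<le> N"
      unfolding p_def by (rule degree_root_poly_le)
    moreover have "degree (pcompose p [:0, q:]) \<le> degree p"
      using degree_pcompose_le[of p "[:0, q:]"] q by simp
    ultimately show "degree (smult (1 / (1 - c)) r) \<le> N"
      unfolding r_def using degree_smult_le[of c "pcompose p [:0, q:]"]
      by (intro order.trans[OF degree_smult_le] degree_diff_le) auto
    show "coeff (smult (1 / (1 - c)) r) 0 = 1"
      using c by (simp add: r p_0 flip: poly_0_coeff_0)
    show "inj_on y {..<N}"
      by (rule pos_increasing_inj_on[OF q_separated_imp_pos_increasing[OF y_sep q(2)]])
  qed (use y y_pos in force)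
  then have "smult (1 - c) (root_poly N (\<lambda>i. 1 / y i)) = r"
    using c by (metis diff_gt_0_iff_gt less_irrefl mult.right_neutral nonzero_mult_div_cancel_left
        smult_1_left smult_smult times_divide_eq_right)
  then show ?thesis using y_sep unfolding r_def by metis
qed

text \<open>For \<open>K = 0\<close> these are the coefficients of \<open>(q w; q)\<^sub>N\<close>, whose zeros are the powers
  \<open>1 / q\<^sup>i\<close>. Passing from \<open>K\<close> to \<open>K + 1\<close> replaces \<open>p(w)\<close> by a multiple of
  \<open>p(w) - a q^K p(q w)\<close>; for \<open>N = K \<rightarrow> \<infinity>\<close> one obtains the Hahn--Exton series.\<close>
definition he_approx :: "real \<Rightarrow> real \<Rightarrow> nat \<Rightarrow> nat \<Rightarrow> nat \<Rightarrow> real" where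
  "he_approx q a N K n = (\<Prod>k<n. - (q ^ Suc k * (1 - q ^ (N - k)) * (1 - a * q ^ (K + k)))
     / ((1 - q ^ Suc k) * (1 - a * q ^ k)))"

lemma he_approx_0_eq_coeff:
  assumes q: "0 < q" "q < 1" and a: "0 < a" "a < 1"
  shows "coeff (root_poly N (\<lambda>i. q ^ Suc i)) n = he_approx q a N 0 n"
proof -
  define p where "p = root_poly N (\<lambda>i. q ^ Suc i)"
  have aq: "1 - a * q ^ k \<noteq> 0" for k
  proof -
    have "a * q ^ k \<le> a * 1"
      using q a by (intro mult_left_mono power_le_one) auto
    then show ?thesis using a by linarith
  qed
  have "pcompose p [:0, q:] * [:1, - q:] = (\<Prod>i<Suc N. [:1, - (q ^ Suc i):])"
    unfolding p_def root_poly_def prod.lessThan_Suc_shift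
    by (simp add: pcompose_prod pcompose_pCons mult_ac)
  also have "\<dots> = p * [:1, - (q ^ Suc N):]"
    by (simp add: p_def root_poly_def)
  finally have fe: "pcompose p [:0, q:] * [:1, - q:] = p * [:1, - (q ^ Suc N):]" .
  have rec: "(1 - q ^ Suc k) * coeff p (Suc k) = - (q ^ Suc k - q ^ Suc N) * coeff p k" for k
    using arg_cong[OF fe, of "\<lambda>p. coeff p (Suc k)"]
    by (simp add: coeff_pcompose_linear algebra_simps)
  show ?thesis
    unfolding p_def[symmetric]
  proof (induction n)
    case 0
    then show ?case by (simp add: p_def coeff_root_poly_0 he_approx_def)
  next
    case (Suc k)
    have q1: "1 - q ^ Suc k \<noteq> 0"
      using power_Suc_less_one[OF q, of k] by simp
    have step: "coeff p (Suc k) = - (q ^ Suc k - q ^ Suc N) / (1 - q ^ Suc k) * coeff p k"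
      using rec[of k] q1 by (simp add: field_simps)
    show ?case
    proof (cases "k \<le> N")
      case True
      then have "q ^ Suc k * q ^ (N - k) = q ^ Suc N"
        by (simp flip: power_add)
      then have "q ^ Suc k * (1 - q ^ (N - k)) = q ^ Suc k - q ^ Suc N"
        unfolding right_diff_distrib by simp
      moreover have "he_approx q a N 0 (Suc k) = he_approx q a N 0 k *
          - (q ^ Suc k * (1 - q ^ (N - k)) * (1 - a * q ^ k) / ((1 - q ^ Suc k) * (1 - a * q ^ k)))"
        unfolding he_approx_def prod.lessThan_Suc by simp
      ultimately have "he_approx q a N 0 (Suc k) = he_approx q a N 0 k * (- (q ^ Suc k - q ^ Suc N) / (1 - q ^ Suc k))"
        using aq[of k] by (simp add: minus_divide_left[symmetric] del: power_Suc minus_diff_eq)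
      then show ?thesis using step Suc by simp
    next
      case False
      then have "coeff p k = 0"
        using degree_root_poly_le[of N "\<lambda>i. q ^ Suc i"] by (intro coeff_eq_0) (simp add: p_def)
      moreover have "he_approx q a N 0 (Suc k) = 0"
        unfolding he_approx_def using False by (intro prod_zero bexI[of _ N]) auto
      ultimately show ?thesis using step by simp
    qed
  qed
qed

lemma he_approx_Suc:
  assumes q: "0 < q" "q < 1" and a: "0 < a" "a < 1"
  shows "(1 - a * q ^ K) * he_approx q a N (Suc K) n = (1 - a * q ^ K * q ^ n) * he_approx q a N K n"
  by (induction n) (auto simp: he_approx_def power_add mult_ac)

lemma he_approx_real_rooted:
  assumes q: "0 < q" "q < 1" and a: "0 < a" "a < 1"
  shows "\<exists>x. q_separated q N x \<and> (\<forall>n. coeff (root_poly N (\<lambda>i. 1 / x i)) n = he_approx q a N K n)"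
proof (induction K)
  case 0
  have "q_separated q N (\<lambda>i. 1 / q ^ Suc i)"
    using q by (auto simp: q_separated_def)
  moreover have "root_poly N (\<lambda>i. 1 / (1 / q ^ Suc i)) = root_poly N (\<lambda>i. q ^ Suc i)"
    by simp
  ultimately show ?case
    using he_approx_0_eq_coeff[OF q a, of N] by metis
next
  case (Suc K)
  then obtain x where x: "q_separated q N x"
    "\<And>n. coeff (root_poly N (\<lambda>i. 1 / x i)) n = he_approx q a N K n" by blast
  have c: "0 < a * q ^ K" "a * q ^ K < 1"
  proof -
    have "a * q ^ K \<le> a * 1"
      using q a by (intro mult_left_mono power_le_one) auto
    then show "a * q ^ K < 1" using a by linarith
  qed (use q a in simp)
  obtain y where y: "q_separated q N y"
    "root_poly N (\<lambda>i. 1 / x i) - smult (a * q ^ K) (pcompose (root_poly N (\<lambda>i. 1 / x i)) [:0, q:])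
      = smult (1 - a * q ^ K) (root_poly N (\<lambda>i. 1 / y i))"
    using q_separated_step[OF q c x(1)] by blast
  have "coeff (root_poly N (\<lambda>i. 1 / y i)) n = he_approx q a N (Suc K) n" for n
  proof -
    have "(1 - a * q ^ K) * coeff (root_poly N (\<lambda>i. 1 / y i)) n
      = (1 - a * q ^ K * q ^ n) * he_approx q a N K n"
      using arg_cong[OF y(2), of "\<lambda>p. coeff p n"] x(2)[of n]
      by (simp add: coeff_pcompose_linear algebra_simps)
    also have "\<dots> = (1 - a * q ^ K) * he_approx q a N (Suc K) n"
      by (rule he_approx_Suc[OF q a, symmetric])
    finally show ?thesis using c by simp
  qed
  then show ?case using y(1) by blast
qed

text \<open>Rolle's theorem for \<open>w p(w)\<^sup>2\<close>, whose derivative is \<open>p(w) (p(w) + 2 w p'(w))\<close>.\<close>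
lemma rolle_root_poly:
  assumes x: "pos_increasing N x"
  defines "p \<equiv> root_poly N (\<lambda>i. 1 / x i)"
  shows "\<exists>y. pos_increasing N y \<and> p + [:0, 2:] * pderiv p = root_poly N (\<lambda>i. 1 / y i)"
proof -
  have pos: "0 < x i" if "i < N" for i
    using x that unfolding pos_increasing_def by blast
  have p_root_iff: "poly p w = 0 \<longleftrightarrow> (\<exists>i<N. w = x i)" for w
    using pos by (force simp: p_def poly_root_poly prod_zero_iff field_simps)
  define r where "r = p + [:0, 2:] * pderiv p"
  define l where "l i = (case i of 0 \<Rightarrow> 0 | Suc j \<Rightarrow> x j)" for i
  define phi where "phi = [:0, 1:] * p ^ 2"
  have phi': "poly (pderiv phi) w = poly p w * poly r w" for w
    by (simp add: phi_def r_def pderiv_mult pderiv_power pderiv_pCons algebra_simps power2_eq_square)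
  have "\<exists>y. l i < y \<and> y < x i \<and> poly r y = 0" if i: "i < N" for i
  proof -
    have li: "l i < x i"
      using pos[OF i] x i unfolding pos_increasing_def by (cases i) (auto simp: l_def)
    have "poly phi (l i) = 0"
    proof (cases i)
      case (Suc j)
      then have "poly p (x j) = 0" using p_root_iff[of "x j"] i Suc_lessD by blast
      then show ?thesis using Suc by (simp add: l_def phi_def)
    qed (simp add: l_def phi_def)
    moreover have "poly phi (x i) = 0"
      using p_root_iff i by (auto simp: phi_def)
    ultimately obtain y where y: "l i < y" "y < x i" "poly (pderiv phi) y = 0"
      using poly_MVT[OF li, of phi] li by auto
    have "poly p y \<noteq> 0"
    proof
      assume "poly p y = 0"
      then obtain j where j: "j < N" "y = x j" using p_root_iff by auto
      with y(2) have "j < i"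
        using pos_increasing_less[OF x, of i j] i j by (metis linorder_neqE_nat order.asym order.irrefl)
      then obtain k where k: "i = Suc k" by (cases i) auto
      with \<open>j < i\<close> have "x j \<le> x k"
        using pos_increasing_less[OF x, of j k] i by (cases "j = k") auto
      then show False using y(1) j k by (simp add: l_def)
    qed
    with y phi' show ?thesis by auto
  qed
  then obtain y where y: "\<And>i. i < N \<Longrightarrow> l i < y i \<and> y i < x i \<and> poly r (y i) = 0"
    by metis
  have inc: "pos_increasing N y"
    unfolding pos_increasing_def
  proof (intro conjI allI impI)
    fix i assume "i < N"
    then have "0 \<le> l i" using pos[of "i - 1"] by (cases i) (auto simp: l_def less_imp_le)
    then show "0 < y i" using y[OF \<open>i < N\<close>] by linarith
  next
    fix i assume "Suc i < N"
    then show "y i < y (Suc i)" using y[of i] y[of "Suc i"] by (simp add: l_def)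
  qed
  have "r = root_poly N (\<lambda>i. 1 / y i)"
  proof (rule poly_eq_root_poly)
    have deg: "degree p \<le> N"
      unfolding p_def by (rule degree_root_poly_le)
    have "degree ([:0, 2:] * pderiv p) \<le> N"
    proof (rule degree_le, intro allI impI)
      fix i assume "N < i"
      then show "coeff ([:0, 2:] * pderiv p) i = 0"
        using deg by (cases i) (auto simp: coeff_pderiv coeff_eq_0)
    qed
    then show "degree r \<le> N"
      unfolding r_def using deg by (intro degree_add_le)
    show "coeff r 0 = 1"
      by (simp add: r_def p_def coeff_root_poly_0)
    show "y i \<noteq> 0 \<and> poly r (y i) = 0" if "i < N" for i
      using y[OF that] inc that unfolding pos_increasing_def by force
  qed (rule pos_increasing_inj_on[OF inc])
  then show ?thesis using inc unfolding r_def by blast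
qed

lemma tendsto_powser_coeffs:
  fixes z :: "'a :: {real_normed_field, banach}"
  assumes lim: "\<And>n. (\<lambda>N. c N n) \<longlonglongrightarrow> b n"
    and dom: "\<And>N n. \<bar>c N n\<bar> \<le> \<bar>b n\<bar>"
    and sm: "\<And>R. summable (\<lambda>n. \<bar>b n\<bar> * R ^ n)"
  shows "(\<lambda>N. \<Sum>n. of_real (c N n) * z ^ n) \<longlonglongrightarrow> (\<Sum>n. of_real (b n) * z ^ n)"
proof -
  have "\<forall>\<^sub>F (n, N) in at_top \<times>\<^sub>F sequentially.
      norm (of_real (c N n) * z ^ n) \<le> \<bar>b n\<bar> * norm z ^ n"
    by (intro always_eventually)
      (auto simp: norm_mult norm_power intro!: mult_right_mono dom)
  moreover have "(\<lambda>N. of_real (c N n) * z ^ n) \<longlonglongrightarrow> of_real (b n) * z ^ n" for n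
    by (intro tendsto_intros lim)
  ultimately show ?thesis
    using tannerys_theorem[of "\<lambda>n N. of_real (c N n) * z ^ n" "\<lambda>n. of_real (b n) * z ^ n"
      sequentially "\<lambda>n. \<bar>b n\<bar> * norm z ^ n"] sm[of "norm z"] by simp
qed

lemma poly_sums:
  fixes p :: "'a :: real_normed_field poly"
  shows "(\<lambda>n. coeff p n * z ^ n) sums poly p z"
  unfolding poly_altdef by (rule sums_finite) (auto simp: coeff_eq_0)

lemma root_poly_Suc: "root_poly (Suc N) t = root_poly N t * [:1, - t N:]"
  by (simp add: root_poly_def)

lemma map_poly_root_poly:
  "map_poly of_real (root_poly N t) = (\<Prod>i<N. [:1, - of_real (t i) :: 'a :: real_normed_field:])"
proof (induction N)
  case 0
  then show ?case by (simp add: root_poly_def)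
next
  case (Suc N)
  have "map_poly of_real (p * [:1, - s:]) = map_poly of_real p * [:1, - of_real s :: 'a:]" for p s
    by (rule poly_eqI) (auto simp: coeff_map_poly coeff_pCons split: nat.splits)
  then show ?case
    using Suc by (simp add: root_poly_Suc)
qed

lemma root_poly_sums:
  fixes z :: "'a :: real_normed_field"
  shows "(\<lambda>n. of_real (coeff (root_poly N t) n) * z ^ n) sums (\<Prod>i<N. 1 - of_real (t i) * z)"
  using poly_sums[of "map_poly of_real (root_poly N t)" z]
  by (simp add: coeff_map_poly, simp add: map_poly_root_poly poly_prod mult.commute)

text \<open>The weights \<open>2 n + 1\<close> turn \<open>p\<close> into \<open>p + 2 z p'\<close>.\<close>
lemma root_poly_log_deriv_sums:
  fixes z :: "'a :: real_normed_field"
  assumes nz: "\<And>i. i < N \<Longrightarrow> of_real (t i) * z \<noteq> 1"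
  shows "(\<lambda>n. of_real (of_nat (2 * n + 1) * coeff (root_poly N t) n) * z ^ n) sums
    ((\<Prod>i<N. 1 - of_real (t i) * z)
      * (1 - 2 * (\<Sum>i<N. of_real (t i) * z / (1 - of_real (t i) * z))))"
proof -
  define p :: "'a poly" where "p = map_poly of_real (root_poly N t)"
  define P where "P = (\<lambda>z :: 'a. \<Prod>i<N. 1 - of_real (t i) * z)"
  have poly_p: "poly p = P"
    by (rule ext) (simp add: p_def P_def map_poly_root_poly poly_prod mult.commute)
  have "(P has_field_derivative P z * (\<Sum>i<N. - of_real (t i) / (1 - of_real (t i) * z))) (at z)"
    unfolding P_def using nz
    by (intro has_field_derivative_prod') (auto intro!: derivative_eq_intros)
  then have pd: "poly (pderiv p) z = P z * (\<Sum>i<N. - of_real (t i) / (1 - of_real (t i) * z))"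
    using poly_DERIV[of p z] DERIV_unique unfolding poly_p by blast
  have "poly (p + [:0, 2:] * pderiv p) z = P z + 2 * z * poly (pderiv p) z"
    by (simp add: poly_p)
  also have "\<dots> = P z * (1 - 2 * (\<Sum>i<N. of_real (t i) * z / (1 - of_real (t i) * z)))"
    unfolding pd by (simp add: algebra_simps sum_distrib_left sum_negf)
  finally have val: "poly (p + [:0, 2:] * pderiv p) z = \<dots>" .
  have "coeff (p + [:0, 2:] * pderiv p) n = of_real (of_nat (2 * n + 1) * coeff (root_poly N t) n)" for n
    by (cases n) (auto simp: p_def coeff_map_poly coeff_pderiv algebra_simps)
  then show ?thesis
    using poly_sums[of "p + [:0, 2:] * pderiv p" z] unfolding val P_def by simp
qed

lemma root_poly_newton:
  "of_nat (Suc k) * coeff (root_poly N t) (Suc k) =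
     - (\<Sum>j\<le>k. (\<Sum>i<N. t i ^ Suc j) * coeff (root_poly N t) (k - j))"
proof -
  define S where "S N = Abs_fps (\<lambda>k. \<Sum>i<N. t i ^ Suc k)" for N
  define F where "F N = fps_of_poly (root_poly N t)" for N
  have F_Suc: "F (Suc N) = F N * (1 - fps_const (t N) * fps_X)" for N
    by (simp add: F_def root_poly_Suc fps_of_poly_mult fps_of_poly_linear' flip: fps_const_neg)
  have geo: "Abs_fps (\<lambda>k. t N ^ Suc k) * (1 - fps_const (t N) * fps_X) = fps_const (t N)" for N
  proof (rule fps_ext)
    fix n show "fps_nth (Abs_fps (\<lambda>k. t N ^ Suc k) * (1 - fps_const (t N) * fps_X)) n = fps_nth (fps_const (t N)) n"
      by (cases n) (auto simp: right_diff_distrib mult.assoc[symmetric])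
  qed
  have "fps_deriv (F N) = - (S N * F N)"
  proof (induction N)
    case 0
    then show ?case by (simp add: F_def S_def root_poly_def fps_eq_iff)
  next
    case (Suc N)
    have S_Suc: "S (Suc N) = S N + Abs_fps (\<lambda>k. t N ^ Suc k)"
      by (simp add: S_def fps_eq_iff)
    have "fps_deriv (F (Suc N)) = - (S N * F (Suc N)) - F N * fps_const (t N)"
      using Suc by (simp add: F_Suc algebra_simps)
    also have "\<dots> = - (S N * F (Suc N)) - F N * (Abs_fps (\<lambda>k. t N ^ Suc k) * (1 - fps_const (t N) * fps_X))"
      by (simp only: geo)
    also have "\<dots> = - (S (Suc N) * F (Suc N))"
      unfolding S_Suc F_Suc by (simp add: algebra_simps)
    finally show ?case .
  qed
  from arg_cong[OF this, of "\<lambda>f. fps_nth f k"] show ?thesis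
    by (simp add: fps_mult_nth S_def F_def atLeast0AtMost)
qed

section \<open>Limits of polynomials with positive zeros\<close>

locale real_rooted_limit =
  fixes b :: "nat \<Rightarrow> real" and t :: "nat \<Rightarrow> nat \<Rightarrow> real"
  assumes t_pos: "\<And>N i. i < N \<Longrightarrow> 0 < t N i"
    and coeff_lim: "\<And>n. (\<lambda>N. coeff (root_poly N (t N)) n) \<longlonglongrightarrow> b n"
    and coeff_le: "\<And>N n. \<bar>coeff (root_poly N (t N)) n\<bar> \<le> \<bar>b n\<bar>"
    and summable_b: "\<And>R. summable (\<lambda>n. \<bar>b n\<bar> * R ^ n)"
begin

definition B :: "real \<Rightarrow> real" where "B w = (\<Sum>n. b n * w ^ n)"

definition power_sum :: "nat \<Rightarrow> nat \<Rightarrow> real" where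
  "power_sum N k = (\<Sum>i<N. t N i ^ Suc k)"

definition \<sigma> :: "nat \<Rightarrow> real" where "\<sigma> k = lim (\<lambda>N. power_sum N k)"

lemma b_0: "b 0 = 1"
  using coeff_lim[of 0] by (simp add: coeff_root_poly_0 LIMSEQ_const_iff)

lemma summable_powser: "summable (\<lambda>n. b n * w ^ n)"
  using summable_b[of "\<bar>w\<bar>"] by - (rule summable_norm_cancel, simp add: abs_mult power_abs)

lemma prod_tendsto:
  fixes z :: "'a :: {real_normed_field, banach}"
  shows "(\<lambda>N. \<Prod>i<N. 1 - of_real (t N i) * z) \<longlonglongrightarrow> (\<Sum>n. of_real (b n) * z ^ n)"
  using tendsto_powser_coeffs[OF coeff_lim coeff_le summable_b, of z]
  by (simp add: sums_unique[OF root_poly_sums, symmetric])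

lemma prod_tendsto_real: "(\<lambda>N. \<Prod>i<N. 1 - t N i * w) \<longlonglongrightarrow> B w"
  using prod_tendsto[of w] by (simp add: B_def)

lemma isCont_B: "isCont B w"
  unfolding B_def by (rule isCont_powser_converges_everywhere[OF summable_powser])

lemma B_0: "B 0 = 1"
  by (simp add: B_def b_0)

lemma eventually_prod_pos:
  assumes r: "0 < r" and pos: "\<forall>w\<in>{0..r}. 0 < B w"
  shows "\<forall>\<^sub>F N in sequentially. \<forall>w. 0 \<le> w \<and> w \<le> r \<longrightarrow> 0 < (\<Prod>i<N. 1 - t N i * w)"
proof -
  have "continuous_on {0..r} B"
    using isCont_B by (simp add: continuous_at_imp_continuous_on)
  from continuous_attains_inf[OF compact_Icc _ this] r
  obtain w0 where w0: "w0 \<in> {0..r}" "\<And>w. w \<in> {0..r} \<Longrightarrow> B w0 \<le> B w" by force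
  define c where "c N n = coeff (root_poly N (t N)) n" for N n
  define e where "e N = (\<Sum>n. \<bar>c N n - b n\<bar> * r ^ n)" for N
  have dom: "\<bar>c N n - b n\<bar> * r ^ n \<le> 2 * (\<bar>b n\<bar> * r ^ n)" for N n
  proof -
    have "\<bar>c N n - b n\<bar> \<le> 2 * \<bar>b n\<bar>"
      using coeff_le[of N n] unfolding c_def by linarith
    then have "\<bar>c N n - b n\<bar> * r ^ n \<le> 2 * \<bar>b n\<bar> * r ^ n"
      using r by (intro mult_right_mono) auto
    then show ?thesis by simp
  qed
  have sm2: "summable (\<lambda>n. 2 * (\<bar>b n\<bar> * r ^ n))"
    by (intro summable_mult summable_b)
  have sm: "summable (\<lambda>n. \<bar>c N n - b n\<bar> * r ^ n)" for N
    using dom r by (intro summable_comparison_test'[OF sm2, of 0]) auto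
  have "e \<longlonglongrightarrow> 0"
  proof -
    have "\<forall>\<^sub>F (n, N) in at_top \<times>\<^sub>F sequentially.
        norm (\<bar>c N n - b n\<bar> * r ^ n) \<le> 2 * (\<bar>b n\<bar> * r ^ n)"
      using dom r by (intro always_eventually) auto
    moreover have "(\<lambda>N. \<bar>c N n - b n\<bar> * r ^ n) \<longlonglongrightarrow> 0" for n
      using coeff_lim[of n] unfolding c_def
      by (auto intro!: tendsto_mult_left_zero tendsto_rabs_zero simp: LIM_zero_iff)
    ultimately show ?thesis
      unfolding e_def
      using tannerys_theorem[of "\<lambda>n N. \<bar>c N n - b n\<bar> * r ^ n" "\<lambda>n. 0" sequentially
          "\<lambda>n. 2 * (\<bar>b n\<bar> * r ^ n)"] sm2 by simp
  qed
  then have "\<forall>\<^sub>F N in sequentially. e N < B w0"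
    using w0(1) pos by (intro order_tendstoD(2)) auto
  then show ?thesis
  proof (eventually_elim, intro allI impI)
    fix N w assume N: "e N < B w0" and w: "0 \<le> w \<and> w \<le> r"
    have cs: "(\<lambda>n. c N n * w ^ n) sums (\<Prod>i<N. 1 - t N i * w)"
      using root_poly_sums[of N "t N" w] by (simp add: c_def)
    have bs: "(\<lambda>n. b n * w ^ n) sums B w"
      unfolding B_def by (rule summable_sums[OF summable_powser])
    have ds: "(\<lambda>n. (b n - c N n) * w ^ n) sums (B w - (\<Prod>i<N. 1 - t N i * w))"
      using sums_diff[OF bs cs] by (simp add: algebra_simps)
    have "(b n - c N n) * w ^ n \<le> \<bar>c N n - b n\<bar> * r ^ n" for n
      using w by (intro mult_mono power_mono) auto
    from sums_le[OF this ds summable_sums[OF sm[of N]]]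
    have "B w - (\<Prod>i<N. 1 - t N i * w) \<le> e N"
      unfolding e_def .
    moreover have "B w0 \<le> B w" using w0(2) w by auto
    ultimately show "0 < (\<Prod>i<N. 1 - t N i * w)" using N by linarith
  qed
qed

lemma eventually_roots_beyond:
  assumes r: "0 < r" and pos: "\<forall>w\<in>{0..r}. 0 < B w"
  shows "\<forall>\<^sub>F N in sequentially. \<forall>i<N. t N i * r < 1"
  using eventually_prod_pos[OF assms]
proof (eventually_elim, intro allI impI)
  fix N i assume N: "\<forall>w. 0 \<le> w \<and> w \<le> r \<longrightarrow> 0 < (\<Prod>i<N. 1 - t N i * w)" and i: "i < N"
  show "t N i * r < 1"
  proof (rule ccontr)
    assume "\<not> t N i * r < 1"
    then have "1 / t N i \<le> r"
      using t_pos[OF i] by (simp add: field_simps)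
    then have "0 < (\<Prod>j<N. 1 - t N j * (1 / t N i))"
      using t_pos[OF i] by (intro N[rule_format] conjI) (simp_all add: less_imp_le)
    moreover have "(\<Prod>j<N. 1 - t N j * (1 / t N i)) = 0"
      using i t_pos[OF i] by (intro prod_zero bexI[of _ i]) auto
    ultimately show False by (rule less_irrefl[THEN notE, OF ord_less_eq_trans])
  qed
qed

lemma power_sum_nonneg: "0 \<le> power_sum N k"
  unfolding power_sum_def by (intro sum_nonneg zero_le_power) (simp add: less_imp_le t_pos)

lemma newton_approx:
  "of_nat (Suc k) * coeff (root_poly N (t N)) (Suc k) =
     - (\<Sum>j\<le>k. power_sum N j * coeff (root_poly N (t N)) (k - j))"
  unfolding power_sum_def by (rule root_poly_newton)

lemma power_sum_tendsto: "(\<lambda>N. power_sum N k) \<longlonglongrightarrow> \<sigma> k"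
proof -
  have "convergent (\<lambda>N. power_sum N k)"
  proof (induction k rule: less_induct)
    case (less k)
    have eq: "(\<lambda>N. power_sum N k) = (\<lambda>N. - of_nat (Suc k) * coeff (root_poly N (t N)) (Suc k)
        - (\<Sum>j<k. power_sum N j * coeff (root_poly N (t N)) (k - j)))"
    proof
      fix N
      show "power_sum N k = - of_nat (Suc k) * coeff (root_poly N (t N)) (Suc k)
          - (\<Sum>j<k. power_sum N j * coeff (root_poly N (t N)) (k - j))"
        using newton_approx[of k N]
        by (simp add: coeff_root_poly_0 lessThan_Suc_atMost[symmetric] algebra_simps)
    qed
    have "(\<lambda>N. power_sum N j) \<longlonglongrightarrow> lim (\<lambda>N. power_sum N j)" if "j < k" for j
      using less[OF that] by (simp add: convergent_LIMSEQ_iff)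
    then have "(\<lambda>N. - of_nat (Suc k) * coeff (root_poly N (t N)) (Suc k)
        - (\<Sum>j<k. power_sum N j * coeff (root_poly N (t N)) (k - j)))
      \<longlonglongrightarrow> - of_nat (Suc k) * b (Suc k) - (\<Sum>j<k. lim (\<lambda>N. power_sum N j) * b (k - j))"
      by (intro tendsto_intros coeff_lim) auto
    then show ?case
      unfolding eq by (rule convergentI)
  qed
  then show ?thesis
    unfolding \<sigma>_def by (simp add: convergent_LIMSEQ_iff)
qed

lemma newton: "of_nat (Suc k) * b (Suc k) = - (\<Sum>j\<le>k. \<sigma> j * b (k - j))"
proof (rule LIMSEQ_unique)
  show "(\<lambda>N. of_nat (Suc k) * coeff (root_poly N (t N)) (Suc k)) \<longlonglongrightarrow> of_nat (Suc k) * b (Suc k)"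
    by (intro tendsto_intros coeff_lim)
  show "(\<lambda>N. of_nat (Suc k) * coeff (root_poly N (t N)) (Suc k)) \<longlonglongrightarrow> - (\<Sum>j\<le>k. \<sigma> j * b (k - j))"
    unfolding newton_approx by (intro tendsto_intros coeff_lim power_sum_tendsto)
qed

lemma \<sigma>_nonneg: "0 \<le> \<sigma> k"
  by (rule LIMSEQ_le_const[OF power_sum_tendsto]) (use power_sum_nonneg in blast)

lemma \<sigma>_log_convex: "(\<sigma> (Suc k))\<^sup>2 \<le> \<sigma> k * \<sigma> (Suc (Suc k))"
proof (rule LIMSEQ_le)
  show "(\<lambda>N. (power_sum N (Suc k))\<^sup>2) \<longlonglongrightarrow> (\<sigma> (Suc k))\<^sup>2"
    by (intro tendsto_intros power_sum_tendsto)
  show "(\<lambda>N. power_sum N k * power_sum N (Suc (Suc k))) \<longlonglongrightarrow> \<sigma> k * \<sigma> (Suc (Suc k))"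
    by (intro tendsto_intros power_sum_tendsto)
  have "(power_sum N (Suc k))\<^sup>2 \<le> power_sum N k * power_sum N (Suc (Suc k))" for N
  proof -
    have "(\<Sum>i<N. sqrt (t N i ^ Suc k) * sqrt (t N i ^ Suc (Suc (Suc k))))\<^sup>2
      \<le> (\<Sum>i<N. (sqrt (t N i ^ Suc k))\<^sup>2) * (\<Sum>i<N. (sqrt (t N i ^ Suc (Suc (Suc k))))\<^sup>2)"
      by (rule Cauchy_Schwarz_ineq_sum)
    moreover have "sqrt (t N i ^ Suc k) * sqrt (t N i ^ Suc (Suc (Suc k))) = t N i ^ Suc (Suc k)"
      if "i < N" for i
      using t_pos[OF that] by (intro real_sqrt_unique[of "t N i ^ Suc (Suc k)", THEN trans[rotated]])
        (auto simp: real_sqrt_mult[symmetric] power2_eq_square)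
    moreover have "(sqrt (t N i ^ m))\<^sup>2 = t N i ^ m" if "i < N" for i m
      using t_pos[OF that] by simp
    ultimately show ?thesis
      unfolding power_sum_def by (simp del: power_Suc)
  qed
  then show "\<exists>N0. \<forall>N\<ge>N0. (power_sum N (Suc k))\<^sup>2 \<le> power_sum N k * power_sum N (Suc (Suc k))"
    by blast
qed

lemma \<sigma>_ratio_le:
  assumes r: "0 < r" and pos: "\<forall>w\<in>{0..r}. 0 < B w"
  shows "\<sigma> (Suc k) * r \<le> \<sigma> k"
proof (rule tendsto_le[OF _ power_sum_tendsto])
  show "(\<lambda>N. power_sum N (Suc k) * r) \<longlonglongrightarrow> \<sigma> (Suc k) * r"
    by (intro tendsto_intros power_sum_tendsto)
  show "\<forall>\<^sub>F N in sequentially. power_sum N (Suc k) * r \<le> power_sum N k"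
    using eventually_roots_beyond[OF assms]
  proof eventually_elim
    case (elim N)
    have "t N i ^ Suc (Suc k) * r \<le> t N i ^ Suc k" if "i < N" for i
    proof -
      have "t N i ^ Suc k * (t N i * r) \<le> t N i ^ Suc k * 1"
        using elim that t_pos[OF that] by (intro mult_left_mono) (auto simp: less_imp_le)
      then show ?thesis by (simp add: mult_ac)
    qed
    then show ?case
      unfolding power_sum_def sum_distrib_right by (intro sum_mono) auto
  qed
qed simp

lemma B_pos_if_\<sigma>_small:
  assumes r: "0 \<le> r" and small: "\<sigma> k * r ^ Suc k < 1"
  shows "0 < B r"
proof -
  obtain \<rho> where \<rho>: "\<sigma> k * r ^ Suc k < \<rho> ^ Suc k" "0 < \<rho>" "\<rho> < 1"
  proof -
    obtain y where y: "\<sigma> k * r ^ Suc k < y" "y < 1"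
      using dense[OF small] by blast
    have "0 \<le> \<sigma> k * r ^ Suc k" using \<sigma>_nonneg r by simp
    then have "0 < y" using y by linarith
    then have "root (Suc k) y ^ Suc k = y" "0 < root (Suc k) y" "root (Suc k) y < 1"
      using y by (auto simp del: power_Suc)
    then show ?thesis using that y by metis
  qed
  have "(\<lambda>N. power_sum N k * r ^ Suc k) \<longlonglongrightarrow> \<sigma> k * r ^ Suc k"
    by (intro tendsto_intros power_sum_tendsto)
  then have ev: "\<forall>\<^sub>F N in sequentially. power_sum N k * r ^ Suc k < \<rho> ^ Suc k"
    using \<rho>(1) by (rule order_tendstoD(2))
  have "exp (- (\<sigma> 0 * r / (1 - \<rho>))) \<le> B r"
  proof (rule tendsto_le[OF _ prod_tendsto_real])
    show "(\<lambda>N. exp (- (power_sum N 0 * r / (1 - \<rho>)))) \<longlonglongrightarrow> exp (- (\<sigma> 0 * r / (1 - \<rho>)))"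
      using \<rho> by (intro tendsto_intros power_sum_tendsto) auto
    show "\<forall>\<^sub>F N in sequentially. exp (- (power_sum N 0 * r / (1 - \<rho>))) \<le> (\<Prod>i<N. 1 - t N i * r)"
      using ev
    proof eventually_elim
      case (elim N)
      have "exp (- (t N i * r / (1 - \<rho>))) \<le> 1 - t N i * r" if i: "i < N" for i
      proof -
        define u where "u = t N i * r"
        have "0 \<le> u" using t_pos[OF i] r by (simp add: u_def)
        have "t N i ^ Suc k \<le> power_sum N k"
          unfolding power_sum_def using i t_pos
          by (intro member_le_sum) (auto intro!: zero_le_power simp: less_imp_le simp del: power_Suc)
        then have "u ^ Suc k \<le> power_sum N k * r ^ Suc k"
          unfolding u_def power_mult_distrib using r by (intro mult_right_mono) auto
        then have "u ^ Suc k < \<rho> ^ Suc k" using elim by linarith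
        then have u: "u < \<rho>" using \<rho>(2) by (meson less_imp_le power_less_imp_less_base)
        have "1 / (1 - u) = 1 + u / (1 - u)" using u \<rho> by (simp add: field_simps)
        also have "\<dots> \<le> 1 + u / (1 - \<rho>)"
          using u \<rho> \<open>0 \<le> u\<close> by (intro add_left_mono divide_left_mono) auto
        also have "\<dots> \<le> exp (u / (1 - \<rho>))" by (rule exp_ge_add_one_self)
        finally have "1 / (1 - u) \<le> exp (u / (1 - \<rho>))" .
        then have "1 / exp (u / (1 - \<rho>)) \<le> 1 - u"
          using u \<rho> by (simp add: field_simps)
        then show ?thesis by (simp add: u_def exp_minus inverse_eq_divide)
      qed
      then have "(\<Prod>i<N. exp (- (t N i * r / (1 - \<rho>)))) \<le> (\<Prod>i<N. 1 - t N i * r)"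
        by (intro prod_mono) auto
      moreover have "(\<Prod>i<N. exp (- (t N i * r / (1 - \<rho>)))) = exp (- (power_sum N 0 * r / (1 - \<rho>)))"
        by (simp add: exp_sum[symmetric] power_sum_def sum_negf sum_distrib_right sum_divide_distrib)
      ultimately show ?case by simp
    qed
  qed simp
  then show ?thesis using less_le_trans[OF exp_gt_zero] by blast
qed

lemma \<sigma>_0: "\<sigma> 0 = - b 1"
  using newton[of 0] by (simp add: b_0)

lemma \<sigma>_1: "\<sigma> 1 = (b 1)\<^sup>2 - 2 * b 2"
  using newton[of 1] by (simp add: b_0 \<sigma>_0 numeral_2_eq_2 power2_eq_square)

lemma \<sigma>_2: "\<sigma> 2 = 3 * b 1 * b 2 - b 1 ^ 3 - 3 * b 3"
proof -
  have "\<sigma> 2 = b 1 * b 2 - b 1 * \<sigma> 1 - 3 * b 3"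
    using newton[of 2] by (simp add: b_0 \<sigma>_0 numeral_2_eq_2 numeral_3_eq_3 algebra_simps)
  then show ?thesis
    unfolding \<sigma>_1 by (simp add: power2_eq_square power3_eq_cube algebra_simps)
qed

text \<open>A geometric tail would make the logarithmic derivative of \<open>B\<close> rational, and then the
  coefficients would satisfy a recurrence whose terms have incompatible orders of magnitude.\<close>
lemma \<sigma>_not_geometric:
  assumes nz: "\<And>n. b n \<noteq> 0" and ratio: "(\<lambda>n. real (Suc n) * (b (Suc n) / b n)) \<longlonglongrightarrow> 0"
    and geo: "\<And>j. \<sigma> (Suc (Suc j)) = \<tau> * \<sigma> (Suc j)"
  shows False
proof -
  define \<rho> where "\<rho> n = real (Suc n) * (b (Suc n) / b n)" for n
  have \<rho>: "\<rho> \<longlonglongrightarrow> 0" using ratio unfolding \<rho>_def .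
  have "(\<lambda>n. \<rho> n * inverse (real (Suc n))) \<longlonglongrightarrow> 0 * 0"
    by (intro tendsto_mult \<rho> LIMSEQ_inverse_real_of_nat)
  moreover have "\<rho> n * inverse (real (Suc n)) = b (Suc n) / b n" for n
    by (simp add: \<rho>_def field_simps del: of_nat_Suc)
  ultimately have \<beta>: "(\<lambda>n. b (Suc n) / b n) \<longlonglongrightarrow> 0" by simp
  have rec: "real (Suc (Suc k)) * b (Suc (Suc k)) - \<tau> * (real (Suc k) * b (Suc k))
      = - \<sigma> 0 * b (Suc k) - (\<sigma> 1 - \<tau> * \<sigma> 0) * b k" for k
  proof -
    have "(\<Sum>j\<le>Suc k. \<sigma> j * b (Suc k - j)) = \<sigma> 0 * b (Suc k) + (\<Sum>j\<le>k. \<sigma> (Suc j) * b (k - j))"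
      by (subst sum.atMost_Suc_shift) simp
    moreover have "(\<Sum>j\<le>k. \<sigma> (Suc j) * b (k - j)) - \<tau> * (\<Sum>j\<le>k. \<sigma> j * b (k - j))
        = (\<Sum>j\<le>k. (\<sigma> (Suc j) - \<tau> * \<sigma> j) * b (k - j))"
      by (simp add: sum_distrib_left sum_subtractf algebra_simps)
    moreover have "\<dots> = (\<sigma> 1 - \<tau> * \<sigma> 0) * b k"
    proof -
      have "(\<sigma> (Suc j) - \<tau> * \<sigma> j) * b (k - j) = (if j = 0 then (\<sigma> 1 - \<tau> * \<sigma> 0) * b k else 0)" for j
        using geo by (cases j) auto
      then show ?thesis by (simp add: sum.delta)
    qed
    ultimately show ?thesis
      unfolding newton by (simp add: algebra_simps)
  qed
  have "\<rho> (Suc k) * (b (Suc k) / b k) - \<tau> * \<rho> k + \<sigma> 0 * (b (Suc k) / b k) = - (\<sigma> 1 - \<tau> * \<sigma> 0)" for k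
    using rec[of k] nz[of k] nz[of "Suc k"] unfolding \<rho>_def
    by (simp add: field_simps del: of_nat_Suc)
  moreover have "(\<lambda>k. \<rho> (Suc k) * (b (Suc k) / b k) - \<tau> * \<rho> k + \<sigma> 0 * (b (Suc k) / b k))
      \<longlonglongrightarrow> 0 * 0 - \<tau> * 0 + \<sigma> 0 * 0"
    by (intro tendsto_intros \<rho> \<beta> LIMSEQ_Suc[OF \<rho>])
  ultimately have \<sigma>_1_eq: "\<sigma> 1 - \<tau> * \<sigma> 0 = 0"
    by (simp add: LIMSEQ_const_iff)
  have lin: "\<rho> (Suc k) = \<tau> * real (Suc k) - \<sigma> 0" for k
    using rec[of k] nz[of "Suc k"] unfolding \<rho>_def \<sigma>_1_eq
    by (simp add: field_simps del: of_nat_Suc)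
  have "(\<lambda>k. \<rho> (Suc (Suc k)) - \<rho> (Suc k)) \<longlonglongrightarrow> 0 - 0"
    by (intro tendsto_intros LIMSEQ_Suc[OF LIMSEQ_Suc[OF \<rho>]] LIMSEQ_Suc[OF \<rho>])
  moreover have "\<rho> (Suc (Suc k)) - \<rho> (Suc k) = \<tau>" for k
    unfolding lin by (simp add: algebra_simps)
  ultimately have "\<tau> = 0" by (simp add: LIMSEQ_const_iff)
  then have "(\<lambda>k. \<rho> (Suc k)) = (\<lambda>k. - \<sigma> 0)"
    using lin by auto
  then have "\<sigma> 0 = 0"
    using LIMSEQ_Suc[OF \<rho>] by (simp add: LIMSEQ_const_iff)
  then show False using nz[of 1] by (simp add: \<sigma>_0)
qed

lemma euler_rayleigh:
  assumes nz: "\<And>n. b n \<noteq> 0" and ratio: "(\<lambda>n. real (Suc n) * (b (Suc n) / b n)) \<longlonglongrightarrow> 0"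
  obtains w where "0 < w" "B w = 0" "\<forall>v\<in>{0..<w}. 0 < B v"
    "0 < \<sigma> 0" "0 < \<sigma> 1" "0 < \<sigma> 2"
    "1 < \<sigma> 0 * w" "\<sigma> 1 * w < \<sigma> 0" "1 < \<sigma> 1 * w\<^sup>2" "\<sigma> 2 * w < \<sigma> 1"
proof -
  note not_geo = \<sigma>_not_geometric[OF nz ratio]
  have pos_if_nz: "0 < B r" if "0 \<le> r" "\<forall>v\<in>{0..r}. B v \<noteq> 0" for r
  proof (rule ccontr)
    assume "\<not> 0 < B r"
    then have "\<exists>v. 0 \<le> v \<and> v \<le> r \<and> B v = 0"
      using that isCont_B by (intro IVT2) (auto simp: B_0)
    with that show False by auto
  qed
  have "\<exists>c\<ge>0. B c = 0"
  proof (rule ccontr)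
    assume "\<not> (\<exists>c\<ge>0. B c = 0)"
    then have pos: "0 < B r" if "0 \<le> r" for r
      using pos_if_nz[OF that] by auto
    have zero: "\<sigma> (Suc k) = 0" for k
    proof (rule ccontr)
      assume "\<sigma> (Suc k) \<noteq> 0"
      then have s: "0 < \<sigma> (Suc k)" using \<sigma>_nonneg[of "Suc k"] by linarith
      define r where "r = (\<sigma> k + 1) / \<sigma> (Suc k)"
      have "0 < r" using s \<sigma>_nonneg[of k] by (simp add: r_def)
      then have "\<sigma> (Suc k) * r \<le> \<sigma> k" using pos by (intro \<sigma>_ratio_le) auto
      then show False using s by (simp add: r_def)
    qed
    show False by (rule not_geo[of 0]) (simp add: zero)
  qed
  then obtain c where c: "0 \<le> c" "B c = 0" by blast
  define Z where "Z = {v \<in> {0..c}. B v = 0}"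
  have "closed Z"
    unfolding Z_def using isCont_B
    by (intro continuous_closed_preimage_constant) (auto simp: continuous_at_imp_continuous_on)
  then have "compact Z"
    by (rule compact_eq_bounded_closed[THEN iffD2, OF conjI, rotated])
      (auto simp: Z_def intro: bounded_subset[of "{0..c}"])
  moreover have "c \<in> Z" using c by (simp add: Z_def)
  ultimately obtain w where w: "w \<in> Z" "\<And>v. v \<in> Z \<Longrightarrow> w \<le> v"
    using compact_attains_inf[of Z] by auto
  have w0: "B w = 0" "0 < w"
    using w(1) B_0 by (auto simp: Z_def less_le)
  have pos: "0 < B v" if "0 \<le> v" "v < w" for v
  proof (rule pos_if_nz[OF that(1)], intro ballI notI)
    fix u assume "u \<in> {0..v}" "B u = 0"
    then have "u \<in> Z" using that w(1) by (auto simp: Z_def)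
    then show False using w(2) that \<open>u \<in> {0..v}\<close> by force
  qed
  have le: "\<sigma> (Suc k) * w \<le> \<sigma> k" for k
  proof -
    have "((\<lambda>r. \<sigma> (Suc k) * r) \<longlongrightarrow> \<sigma> (Suc k) * w) (at_left w)"
      by (intro tendsto_intros)
    moreover have "\<forall>\<^sub>F r in at_left w. \<sigma> (Suc k) * r \<le> \<sigma> k"
      using eventually_at_left_real[OF w0(2)]
    proof eventually_elim
      case (elim r)
      then show ?case using pos by (intro \<sigma>_ratio_le) auto
    qed
    ultimately show ?thesis
      by (intro tendsto_upperbound) auto
  qed
  have ge: "1 \<le> \<sigma> k * w ^ Suc k" for k
    using B_pos_if_\<sigma>_small[of w k] w0 by force
  have \<sigma>_pos: "0 < \<sigma> k" for k
  proof -
    have "\<sigma> k \<noteq> 0" using ge[of k] by auto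
    then show ?thesis using \<sigma>_nonneg[of k] by linarith
  qed
  have strict: "\<sigma> 2 * w < \<sigma> 1"
  proof (rule ccontr)
    assume "\<not> \<sigma> 2 * w < \<sigma> 1"
    then have eq: "\<sigma> 2 * w = \<sigma> 1" using le[of 1] by (simp add: numeral_2_eq_2)
    have geo: "\<sigma> (Suc (Suc j)) * w = \<sigma> (Suc j)" for j
    proof (induction j)
      case 0
      then show ?case using eq by (simp add: numeral_2_eq_2)
    next
      case (Suc j)
      have "\<sigma> (Suc (Suc j)) * \<sigma> (Suc (Suc j)) \<le> \<sigma> (Suc (Suc j)) * (w * \<sigma> (Suc (Suc (Suc j))))"
        using \<sigma>_log_convex[of "Suc j"] unfolding Suc[symmetric] by (simp add: power2_eq_square mult_ac)
      then have "\<sigma> (Suc (Suc j)) \<le> \<sigma> (Suc (Suc (Suc j))) * w"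
        using \<sigma>_pos[of "Suc (Suc j)"] by (simp add: mult_ac)
      then show ?case using le[of "Suc (Suc j)"] by simp
    qed
    have "\<sigma> (Suc (Suc j)) = 1 / w * \<sigma> (Suc j)" for j
      using geo[of j] w0(2) by (simp add: field_simps)
    then show False by (rule not_geo)
  qed
  have s1: "\<sigma> 1 * w < \<sigma> 0"
  proof -
    have "\<sigma> 1 * (\<sigma> 1 * w) \<le> \<sigma> 0 * (\<sigma> 2 * w)"
      using mult_right_mono[OF \<sigma>_log_convex[of 0], of w] w0(2)
      by (simp add: power2_eq_square numeral_2_eq_2 mult_ac)
    also have "\<dots> < \<sigma> 0 * \<sigma> 1"
      using strict \<sigma>_pos[of 0] by simp
    finally have "\<sigma> 1 * (\<sigma> 1 * w) < \<sigma> 1 * \<sigma> 0" by (simp add: mult.commute)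
    then show ?thesis using \<sigma>_pos[of 1] by (simp only: mult_less_cancel_left_pos)
  qed
  have g1: "1 < \<sigma> 1 * w\<^sup>2"
  proof -
    have "1 \<le> \<sigma> 2 * w * w\<^sup>2"
      using ge[of 2] by (simp add: numeral_2_eq_2 mult_ac)
    also have "\<dots> < \<sigma> 1 * w\<^sup>2"
      using strict w0(2) by (intro mult_strict_right_mono) auto
    finally show ?thesis .
  qed
  have g0: "1 < \<sigma> 0 * w"
  proof -
    have "1 < \<sigma> 1 * w * w"
      using g1 by (simp add: power2_eq_square mult_ac)
    also have "\<dots> < \<sigma> 0 * w"
      using s1 w0(2) by (intro mult_strict_right_mono) auto
    finally show ?thesis .
  qed
  show thesis
    by (rule that[OF w0(2,1) _ \<sigma>_pos \<sigma>_pos \<sigma>_pos g0 s1 g1 strict]) (use pos in auto)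
qed

end

lemma Re_Moebius_le:
  fixes z :: complex
  assumes "norm z < 1"
  shows "Re (z / (1 - z)) \<le> norm z / (1 - norm z)"
proof -
  have "z \<noteq> 1" using assms by auto
  have "Re (1 / (1 - z)) \<le> norm (1 / (1 - z))" by (rule complex_Re_le_cmod)
  also have "\<dots> \<le> 1 / (1 - norm z)"
    using norm_triangle_ineq2[of 1 z] assms unfolding norm_divide norm_one by (intro divide_left_mono mult_pos_pos) auto
  finally have "Re (1 / (1 - z)) - 1 \<le> 1 / (1 - norm z) - 1" by simp
  moreover have "z / (1 - z) = 1 / (1 - z) - 1"
    using \<open>z \<noteq> 1\<close> by (simp add: field_simps)
  moreover have "1 / (1 - norm z) - 1 = norm z / (1 - norm z)"
    using assms by (simp add: field_simps)
  ultimately show ?thesis by simp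
qed

context real_rooted_limit
begin

lemma log_deriv_tendsto:
  fixes z :: "'a :: {real_normed_field, banach}"
  assumes sm: "\<And>R. summable (\<lambda>n. \<bar>of_nat (2 * n + 1) * b n\<bar> * R ^ n)"
    and nz: "\<forall>\<^sub>F N in sequentially. \<forall>i<N. of_real (t N i) * z \<noteq> 1"
  shows "(\<lambda>N. (\<Prod>i<N. 1 - of_real (t N i) * z)
      * (1 - 2 * (\<Sum>i<N. of_real (t N i) * z / (1 - of_real (t N i) * z))))
    \<longlonglongrightarrow> (\<Sum>n. of_real (of_nat (2 * n + 1) * b n) * z ^ n)"
proof (rule Lim_transform_eventually)
  show "(\<lambda>N. \<Sum>n. of_real (of_nat (2 * n + 1) * coeff (root_poly N (t N)) n) * z ^ n)
      \<longlonglongrightarrow> (\<Sum>n. of_real (of_nat (2 * n + 1) * b n) * z ^ n)"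
    using coeff_le
    by (intro tendsto_powser_coeffs tendsto_intros coeff_lim sm)
      (auto simp: abs_mult intro!: mult_left_mono)
  show "\<forall>\<^sub>F N in sequentially. (\<Sum>n. of_real (of_nat (2 * n + 1) * coeff (root_poly N (t N)) n) * z ^ n) =
      (\<Prod>i<N. 1 - of_real (t N i) * z)
      * (1 - 2 * (\<Sum>i<N. of_real (t N i) * z / (1 - of_real (t N i) * z)))"
    using nz
  proof eventually_elim
    case (elim N)
    then show ?case by (intro sums_unique[symmetric] root_poly_log_deriv_sums) auto
  qed
qed

text \<open>Each factor of the approximating products satisfies this inequality, by \<open>Re_Moebius_le\<close>.\<close>
lemma Re_log_deriv_ge:
  fixes z :: complex
  assumes sm: "\<And>R. summable (\<lambda>n. \<bar>of_nat (2 * n + 1) * b n\<bar> * R ^ n)"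
    and z: "z \<noteq> 0" and pos: "\<forall>w\<in>{0..norm z}. 0 < B w"
  shows "(\<Sum>n. of_nat (2 * n + 1) * b n * norm z ^ n) / B (norm z)
    \<le> Re ((\<Sum>n. of_real (of_nat (2 * n + 1) * b n) * z ^ n) / (\<Sum>n. of_real (b n) * z ^ n))"
proof -
  define \<rho> where "\<rho> = norm z"
  have "0 < \<rho>" using z by (simp add: \<rho>_def)
  define P where "P N = (\<Prod>i<N. 1 - of_real (t N i) * z)" for N
  define R where "R N = (\<Prod>i<N. 1 - t N i * \<rho>)" for N
  define SP where "SP N = 1 - 2 * (\<Sum>i<N. of_real (t N i) * z / (1 - of_real (t N i) * z))" for N
  define SR where "SR N = 1 - 2 * (\<Sum>i<N. t N i * \<rho> / (1 - t N i * \<rho>))" for N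
  have ev: "\<forall>\<^sub>F N in sequentially. \<forall>i<N. t N i * \<rho> < 1"
    using eventually_roots_beyond[OF \<open>0 < \<rho>\<close>] pos unfolding \<rho>_def by blast
  have norm_tz: "norm (of_real (t N i) * z) = t N i * \<rho>" if "i < N" for N i
    using t_pos[OF that] by (simp add: norm_mult \<rho>_def)
  have P_lim: "P \<longlonglongrightarrow> (\<Sum>n. of_real (b n) * z ^ n)"
    unfolding P_def by (rule prod_tendsto)
  have R_lim: "R \<longlonglongrightarrow> B \<rho>"
    unfolding R_def by (rule prod_tendsto_real)
  have R_le: "\<forall>\<^sub>F N in sequentially. R N \<le> norm (P N)"
    using ev
  proof eventually_elim
    case (elim N)
    have "1 - t N i * \<rho> \<le> norm (1 - of_real (t N i) * z)" if "i < N" for i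
      using norm_triangle_ineq2[of 1 "of_real (t N i) * z"] norm_tz[OF that] by simp
    then show ?case
      using elim unfolding P_def R_def prod_norm[symmetric]
      by (intro prod_mono) (auto simp: less_imp_le)
  qed
  have nz_lim: "B \<rho> \<le> norm (\<Sum>n. of_real (b n) * z ^ n)"
    by (rule tendsto_le[OF _ tendsto_norm[OF P_lim] R_lim R_le]) simp
  have "0 < B \<rho>" using pos \<open>0 < \<rho>\<close> by (auto simp: \<rho>_def)
  have PSP_lim: "(\<lambda>N. P N * SP N) \<longlonglongrightarrow> (\<Sum>n. of_real (of_nat (2 * n + 1) * b n) * z ^ n)"
    unfolding P_def SP_def
  proof (rule log_deriv_tendsto[OF sm])
    show "\<forall>\<^sub>F N in sequentially. \<forall>i<N. complex_of_real (t N i) * z \<noteq> 1"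
      using ev
    proof eventually_elim
      case (elim N)
      then show ?case using norm_tz by (metis less_irrefl norm_one)
    qed
  qed
  have RSR_lim: "(\<lambda>N. R N * SR N) \<longlonglongrightarrow> (\<Sum>n. of_nat (2 * n + 1) * b n * \<rho> ^ n)"
  proof -
    have "\<forall>\<^sub>F N in sequentially. \<forall>i<N. of_real (t N i) * \<rho> \<noteq> 1"
      using ev by eventually_elim fastforce
    from log_deriv_tendsto[OF sm this] show ?thesis
      unfolding R_def SR_def of_real_eq_id id_apply .
  qed
  have "(\<Sum>n. of_nat (2 * n + 1) * b n * \<rho> ^ n) / B \<rho>
    \<le> Re ((\<Sum>n. of_real (of_nat (2 * n + 1) * b n) * z ^ n) / (\<Sum>n. of_real (b n) * z ^ n))"
  proof (rule tendsto_le)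
    show "(\<lambda>N. Re (P N * SP N / P N)) \<longlonglongrightarrow>
      Re ((\<Sum>n. of_real (of_nat (2 * n + 1) * b n) * z ^ n) / (\<Sum>n. of_real (b n) * z ^ n))"
      using nz_lim \<open>0 < B \<rho>\<close> by (intro tendsto_intros PSP_lim P_lim) auto
    show "(\<lambda>N. R N * SR N / R N) \<longlonglongrightarrow> (\<Sum>n. of_nat (2 * n + 1) * b n * \<rho> ^ n) / B \<rho>"
      using \<open>0 < B \<rho>\<close> by (intro tendsto_intros RSR_lim R_lim) auto
    show "\<forall>\<^sub>F N in sequentially. R N * SR N / R N \<le> Re (P N * SP N / P N)"
      using ev R_le
    proof eventually_elim
      case (elim N)
      have "0 < R N" using elim(1) unfolding R_def by (intro prod_pos) auto
      then have "P N \<noteq> 0" using elim(2) by auto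
      have "Re (of_real (t N i) * z / (1 - of_real (t N i) * z)) \<le> t N i * \<rho> / (1 - t N i * \<rho>)"
        if "i < N" for i
        using Re_Moebius_le[of "of_real (t N i) * z"] elim(1) that norm_tz[OF that] by simp
      then have "(\<Sum>i<N. Re (of_real (t N i) * z / (1 - of_real (t N i) * z)))
          \<le> (\<Sum>i<N. t N i * \<rho> / (1 - t N i * \<rho>))"
        by (intro sum_mono) auto
      then have "SR N \<le> Re (SP N)"
        by (simp add: SR_def SP_def Re_sum)
      then show ?case using \<open>0 < R N\<close> \<open>P N \<noteq> 0\<close> by simp
    qed
  qed simp
  then show ?thesis unfolding \<rho>_def .
qed

end

section \<open>The Hahn--Exton series\<close>

definition he_coeff :: "real \<Rightarrow> real \<Rightarrow> nat \<Rightarrow> real" where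
  "he_coeff q a n = (\<Prod>k<n. - (q ^ Suc k) / ((1 - q ^ Suc k) * (1 - a * q ^ k)))"

definition starlike_coeff :: "real \<Rightarrow> real \<Rightarrow> nat \<Rightarrow> real" where
  "starlike_coeff q a n = of_nat (2 * n + 1) * he_coeff q a n"

lemma summable_if_ratio_tendsto_0:
  fixes c :: "nat \<Rightarrow> real"
  assumes nz: "\<And>n. c n \<noteq> 0" and lim: "(\<lambda>n. c (Suc n) / c n) \<longlonglongrightarrow> 0"
  shows "summable (\<lambda>n. \<bar>c n\<bar> * R ^ n)"
proof -
  have "(\<lambda>n. \<bar>c (Suc n) / c n\<bar> * \<bar>R\<bar>) \<longlonglongrightarrow> 0"
    using tendsto_mult_left_zero[OF tendsto_rabs_zero[OF lim]] .
  then have "\<forall>\<^sub>F n in sequentially. \<bar>c (Suc n) / c n\<bar> * \<bar>R\<bar> < 1 / 2"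
    by (rule order_tendstoD) simp
  then obtain N where N: "\<And>n. N \<le> n \<Longrightarrow> \<bar>c (Suc n) / c n\<bar> * \<bar>R\<bar> < 1 / 2"
    unfolding eventually_sequentially by blast
  show ?thesis
  proof (rule summable_ratio_test[of "1 / 2" N])
    fix n assume "N \<le> n"
    have "norm (\<bar>c (Suc n)\<bar> * R ^ Suc n) = (\<bar>c (Suc n) / c n\<bar> * \<bar>R\<bar>) * norm (\<bar>c n\<bar> * R ^ n)"
      using nz[of n] by (simp add: abs_mult power_abs)
    also have "\<dots> \<le> 1 / 2 * norm (\<bar>c n\<bar> * R ^ n)"
      using N[OF \<open>N \<le> n\<close>] by (intro mult_right_mono) auto
    finally show "norm (\<bar>c (Suc n)\<bar> * R ^ Suc n) \<le> 1 / 2 * norm (\<bar>c n\<bar> * R ^ n)" .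
  qed simp
qed

locale hahn_exton =
  fixes q a :: real
  assumes q: "0 < q" "q < 1" and a: "0 < a" "a < 1"
begin

lemma q_power_less_1: "q ^ Suc k < 1"
  using q by (intro power_Suc_less_one)

lemma aq_power_less_1: "a * q ^ k < 1"
proof -
  have "a * q ^ k \<le> a * 1"
    using q a by (intro mult_left_mono power_le_one) auto
  then show ?thesis using a by linarith
qed

lemma he_coeff_nonzero: "he_coeff q a n \<noteq> 0"
  using q q_power_less_1 aq_power_less_1 unfolding he_coeff_def
  by (auto simp: prod_zero_iff less_imp_neq simp del: power_Suc)

lemma starlike_coeff_nonzero: "starlike_coeff q a n \<noteq> 0"
  using he_coeff_nonzero by (simp add: starlike_coeff_def del: of_nat_Suc of_nat_add)

lemma he_coeff_ratio: "he_coeff q a (Suc n) / he_coeff q a n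
    = - (q ^ Suc n) / ((1 - q ^ Suc n) * (1 - a * q ^ n))"
proof -
  have "he_coeff q a (Suc n) = he_coeff q a n * (- (q ^ Suc n) / ((1 - q ^ Suc n) * (1 - a * q ^ n)))"
    by (simp only: he_coeff_def prod.lessThan_Suc)
  then show ?thesis using he_coeff_nonzero[of n] by (simp del: power_Suc)
qed

lemma LIMSEQ_n_q_power: "(\<lambda>n. real n * q ^ n) \<longlonglongrightarrow> 0"
  using powser_times_n_limit_0[of q] q by simp

lemma he_coeff_ratio_tendsto:
  "(\<lambda>n. real (Suc n) * (he_coeff q a (Suc n) / he_coeff q a n)) \<longlonglongrightarrow> 0"
proof -
  have "(\<lambda>n. - (real (Suc n) * q ^ Suc n) / ((1 - q ^ Suc n) * (1 - a * q ^ n)))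
      \<longlonglongrightarrow> - 0 / ((1 - 0) * (1 - a * 0))"
    using q LIMSEQ_power_zero[of q]
    by (intro tendsto_intros LIMSEQ_Suc[OF LIMSEQ_n_q_power] LIMSEQ_Suc[OF LIMSEQ_power_zero]) auto
  then show ?thesis
    unfolding he_coeff_ratio by (simp del: of_nat_Suc power_Suc)
qed

lemma starlike_coeff_ratio_tendsto:
  "(\<lambda>n. real (Suc n) * (starlike_coeff q a (Suc n) / starlike_coeff q a n)) \<longlonglongrightarrow> 0"
proof (rule tendsto_0_le[OF he_coeff_ratio_tendsto, of _ 3], rule always_eventually, rule allI)
  fix n
  have "starlike_coeff q a (Suc n) / starlike_coeff q a n
    = real (2 * Suc n + 1) / real (2 * n + 1) * (he_coeff q a (Suc n) / he_coeff q a n)"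
    by (simp add: starlike_coeff_def)
  moreover have "real (2 * Suc n + 1) / real (2 * n + 1) \<le> 3"
    by (simp add: field_simps)
  then have "real (2 * Suc n + 1) / real (2 * n + 1) * \<bar>he_coeff q a (Suc n) / he_coeff q a n\<bar>
    \<le> 3 * \<bar>he_coeff q a (Suc n) / he_coeff q a n\<bar>"
    by (rule mult_right_mono) simp
  then have "real (Suc n) * (real (2 * Suc n + 1) / real (2 * n + 1) * \<bar>he_coeff q a (Suc n) / he_coeff q a n\<bar>)
    \<le> real (Suc n) * (3 * \<bar>he_coeff q a (Suc n) / he_coeff q a n\<bar>)"
    by (rule mult_left_mono) simp
  ultimately show "norm (real (Suc n) * (starlike_coeff q a (Suc n) / starlike_coeff q a n))
    \<le> norm (real (Suc n) * (he_coeff q a (Suc n) / he_coeff q a n)) * 3"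
    by (simp add: abs_mult mult_ac)
qed

lemma ratio_tendsto_0:
  assumes "(\<lambda>n. real (Suc n) * (c (Suc n) / c n)) \<longlonglongrightarrow> 0"
  shows "(\<lambda>n. c (Suc n) / c n :: real) \<longlonglongrightarrow> 0"
proof (rule tendsto_0_le[OF assms, of _ 1], rule always_eventually, rule allI)
  fix n
  have "1 * \<bar>c (Suc n) / c n\<bar> \<le> real (Suc n) * \<bar>c (Suc n) / c n\<bar>"
    by (rule mult_right_mono) auto
  then show "norm (c (Suc n) / c n) \<le> norm (real (Suc n) * (c (Suc n) / c n)) * 1"
    by (simp add: abs_mult)
qed

lemmas summable_he_coeff =
  summable_if_ratio_tendsto_0[OF he_coeff_nonzero ratio_tendsto_0[OF he_coeff_ratio_tendsto]]

lemmas summable_starlike_coeff =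
  summable_if_ratio_tendsto_0[OF starlike_coeff_nonzero ratio_tendsto_0[OF starlike_coeff_ratio_tendsto]]

lemma he_approx_tendsto: "(\<lambda>N. he_approx q a N N n) \<longlonglongrightarrow> he_coeff q a n"
proof -
  have "(\<lambda>N. - (q ^ Suc k * (1 - q ^ (N - k)) * (1 - a * q ^ (N + k)))
     / ((1 - q ^ Suc k) * (1 - a * q ^ k)))
    \<longlonglongrightarrow> - (q ^ Suc k * (1 - 0) * (1 - a * 0)) / ((1 - q ^ Suc k) * (1 - a * q ^ k))" for k
  proof -
    have p: "(\<lambda>N. q ^ N) \<longlonglongrightarrow> 0" using q by (intro LIMSEQ_power_zero) auto
    have "(\<lambda>N. q ^ (N - k)) \<longlonglongrightarrow> 0"
      by (rule LIMSEQ_offset[of _ k]) (simp add: p)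
    moreover have "(\<lambda>N. q ^ (N + k)) \<longlonglongrightarrow> 0"
      by (rule LIMSEQ_ignore_initial_segment[OF p])
    moreover have "(1 - q ^ Suc k) * (1 - a * q ^ k) \<noteq> 0"
      using q_power_less_1[of k] aq_power_less_1[of k] by (simp add: less_imp_neq del: power_Suc)
    ultimately show ?thesis by (intro tendsto_intros)
  qed
  then show ?thesis
    unfolding he_approx_def he_coeff_def by (intro tendsto_prod) (simp del: power_Suc)
qed

lemma abs_he_approx_le: "\<bar>he_approx q a N K n\<bar> \<le> \<bar>he_coeff q a n\<bar>"
  unfolding he_approx_def he_coeff_def abs_prod
proof (intro prod_mono conjI)
  fix k
  define D where "D = \<bar>(1 - q ^ Suc k) * (1 - a * q ^ k)\<bar>"
  have "\<bar>1 - q ^ (N - k)\<bar> * \<bar>1 - a * q ^ (K + k)\<bar> \<le> 1 * 1"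
    using q a aq_power_less_1[of "K + k"] by (intro mult_mono) (auto simp: power_le_one)
  then have "q ^ Suc k * (\<bar>1 - q ^ (N - k)\<bar> * \<bar>1 - a * q ^ (K + k)\<bar>) \<le> q ^ Suc k * (1 * 1)"
    using q by (intro mult_left_mono) auto
  then have "q ^ Suc k * (\<bar>1 - q ^ (N - k)\<bar> * \<bar>1 - a * q ^ (K + k)\<bar>) / D \<le> q ^ Suc k * (1 * 1) / D"
    unfolding D_def by (intro divide_right_mono abs_ge_zero)
  then show "\<bar>- (q ^ Suc k * (1 - q ^ (N - k)) * (1 - a * q ^ (K + k))) / ((1 - q ^ Suc k) * (1 - a * q ^ k))\<bar>
    \<le> \<bar>- (q ^ Suc k) / ((1 - q ^ Suc k) * (1 - a * q ^ k))\<bar>"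
    using q unfolding D_def by (simp add: abs_mult mult.assoc del: power_Suc)
qed simp

lemma real_rooted_limits:
  obtains tF tH where "real_rooted_limit (he_coeff q a) tF"
    "real_rooted_limit (starlike_coeff q a) tH"
proof -
  have "\<forall>N. \<exists>x. q_separated q N x \<and> (\<forall>n. coeff (root_poly N (\<lambda>i. 1 / x i)) n = he_approx q a N N n)"
    using he_approx_real_rooted[OF q a] by blast
  from choice[OF this] obtain x where x: "\<And>N. q_separated q N (x N)"
    "\<And>N n. coeff (root_poly N (\<lambda>i. 1 / x N i)) n = he_approx q a N N n"
    by blast
  have inc: "pos_increasing N (x N)" for N
    by (rule q_separated_imp_pos_increasing[OF x(1) q(2)])
  have "\<forall>N. \<exists>y. pos_increasing N y \<and> root_poly N (\<lambda>i. 1 / x N i)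
      + [:0, 2:] * pderiv (root_poly N (\<lambda>i. 1 / x N i)) = root_poly N (\<lambda>i. 1 / y i)"
    using rolle_root_poly[OF inc] by blast
  from choice[OF this] obtain y where y: "\<And>N. pos_increasing N (y N)"
    "\<And>N. root_poly N (\<lambda>i. 1 / x N i) + [:0, 2:] * pderiv (root_poly N (\<lambda>i. 1 / x N i))
      = root_poly N (\<lambda>i. 1 / y N i)"
    by blast
  have y_coeff: "coeff (root_poly N (\<lambda>i. 1 / y N i)) n = of_nat (2 * n + 1) * he_approx q a N N n" for N n
    unfolding y(2)[symmetric] x(2)[symmetric]
    by (cases n) (auto simp: coeff_pderiv algebra_simps)
  have "real_rooted_limit (he_coeff q a) (\<lambda>N i. 1 / x N i)"
  proof
    show "0 < 1 / x N i" if "i < N" for N i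
      using inc that by (auto simp: pos_increasing_def)
  qed (simp_all only: x(2) he_approx_tendsto abs_he_approx_le summable_he_coeff)
  moreover have "real_rooted_limit (starlike_coeff q a) (\<lambda>N i. 1 / y N i)"
  proof
    show "0 < 1 / y N i" if "i < N" for N i
      using y(1) that by (auto simp: pos_increasing_def)
    show "(\<lambda>N. coeff (root_poly N (\<lambda>i. 1 / y N i)) n) \<longlonglongrightarrow> starlike_coeff q a n" for n
      unfolding y_coeff starlike_coeff_def by (intro tendsto_intros he_approx_tendsto)
    show "\<bar>coeff (root_poly N (\<lambda>i. 1 / y N i)) n\<bar> \<le> \<bar>starlike_coeff q a n\<bar>" for N n
      unfolding y_coeff starlike_coeff_def abs_mult by (intro mult_left_mono abs_he_approx_le) auto
  qed (rule summable_starlike_coeff)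
  ultimately show thesis by (rule that)
qed

end

lemma prodinf_q_pochhammer_nonzero:
  assumes q: "0 < q" "q < 1" and a: "0 < a" "a < 1"
  shows "qpoch_inf a q \<noteq> 0"
  unfolding qpoch_inf_def
proof (rule prodinf_nonzero)
  interpret hahn_exton q a by unfold_locales (fact q a)+
  have "summable (\<lambda>k. \<bar>- (a * q ^ k)\<bar>)"
    using q a by (simp add: abs_mult summable_mult summable_geometric)
  moreover have "- (a * q ^ k) \<noteq> - 1" for k
    using aq_power_less_1[of k] by simp
  ultimately show "convergent_prod (\<lambda>k. 1 - a * q ^ k)"
    using summable_imp_convergent_prod_real[of "\<lambda>k. - (a * q ^ k)"] by simp
  show "1 - a * q ^ i \<noteq> 0" for i using aq_power_less_1[of i] by simp
qed

context hahn_exton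
begin

definition he_fun :: "'a \<Rightarrow> 'a :: {real_normed_field, banach}" where
  "he_fun z = (\<Sum>n. of_real (he_coeff q a n) * z ^ n)"

definition starlike_fun :: "'a \<Rightarrow> 'a :: {real_normed_field, banach}" where
  "starlike_fun z = (\<Sum>n. of_real (starlike_coeff q a n) * z ^ n)"

lemma summable_he: "summable (\<lambda>n. of_real (he_coeff q a n) * (z :: 'a :: {real_normed_field, banach}) ^ n)"
  using summable_he_coeff[of "norm z"]
  by - (rule summable_norm_cancel, simp add: norm_mult norm_power)

lemma he_fun_has_derivative:
  fixes z :: "'a :: {real_normed_field, banach}"
  obtains D where "(he_fun has_field_derivative D) (at z)" "2 * z * D = starlike_fun z - he_fun z"
proof -
  define D where "D = (\<Sum>n. diffs (\<lambda>n. of_real (he_coeff q a n)) n * z ^ n)"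
  have der: "(he_fun has_field_derivative D) (at z)"
    unfolding D_def he_fun_def by (rule termdiffs_strong_converges_everywhere[OF summable_he])
  have "(\<lambda>n. diffs (\<lambda>n. of_real (he_coeff q a n)) n * z ^ n) sums D"
    unfolding D_def by (intro summable_sums termdiff_converges_all summable_he)
  then have "(\<lambda>n. diffs (\<lambda>n. of_real (he_coeff q a n)) n * z ^ n * z) sums (D * z)"
    by (rule sums_mult2)
  then have "(\<lambda>n. of_nat (Suc n) * of_real (he_coeff q a (Suc n)) * z ^ Suc n) sums (D * z)"
    by (simp add: diffs_def mult_ac)
  then have "(\<lambda>n. of_nat n * of_real (he_coeff q a n) * z ^ n) sums (D * z)"
    by (subst (asm) sums_Suc_iff) simp
  then have "(\<lambda>n. 2 * (of_nat n * of_real (he_coeff q a n) * z ^ n) + of_real (he_coeff q a n) * z ^ n)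
      sums (2 * (D * z) + he_fun z)"
    unfolding he_fun_def by (intro sums_add sums_mult summable_sums summable_he)
  moreover have "2 * (of_nat n * of_real (he_coeff q a n) * z ^ n) + of_real (he_coeff q a n) * z ^ n
      = of_real (starlike_coeff q a n) * z ^ n" for n
    by (simp add: starlike_coeff_def algebra_simps)
  ultimately have "starlike_fun z = 2 * (D * z) + he_fun z"
    unfolding starlike_fun_def by (simp add: sums_unique[symmetric])
  with der show thesis by (intro that) (auto simp: algebra_simps)
qed

lemma he_coeff_numeral:
  "he_coeff q a 1 = - q / ((1 - q) * (1 - a))"
  "he_coeff q a 2 = q ^ 3 / ((1 - q) * (1 - q ^ 2) * (1 - a) * (1 - a * q))"
  "he_coeff q a 3 = - (q ^ 6) / ((1 - q) * (1 - q ^ 2) * (1 - q ^ 3)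
      * (1 - a) * (1 - a * q) * (1 - a * q ^ 2))"
  by (simp_all add: he_coeff_def numeral_2_eq_2 numeral_3_eq_3 eval_nat_numeral mult_ac)

definition \<Delta> :: real where "\<Delta> = 9 - q + a * q - 9 * a * q ^ 2"

definition T :: real where
  "T = 6 * (a * q) - 12 * (a * q ^ 2) - 20 * (a * q ^ 3) - 12 * (a * q ^ 4) + 6 * (a * q ^ 5)
    + a\<^sup>2 * q ^ 3 + (3 * (a\<^sup>2 * q ^ 4) + 3 * (a\<^sup>2 * q ^ 5) + 9 * (a\<^sup>2 * q ^ 6) + q ^ 3 + 3 * q ^ 2 + 3 * q + 9)"

definition s1 :: real where "s1 = 3 * q / ((1 - q) * (1 - a))"
definition s2 :: real where
  "s2 = q\<^sup>2 * \<Delta> / ((1 - a)\<^sup>2 * (1 - q)\<^sup>2 * (1 - a * q) * (1 + q))"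
definition s3 :: real where
  "s3 = 3 * q ^ 3 * T / ((1 - q) ^ 3 * (1 - a) ^ 3 * (1 - a * q) * (1 - a * q\<^sup>2) * (1 + q) * (1 + q + q\<^sup>2))"

lemma nonzero: "1 - q \<noteq> 0" "1 - a \<noteq> 0" "1 - a * q \<noteq> 0" "1 - a * q\<^sup>2 \<noteq> 0" "1 + q \<noteq> 0" "1 + q + q\<^sup>2 \<noteq> 0"
  using q a aq_power_less_1[of 1] aq_power_less_1[of 2]
    add_pos_nonneg[of "1 + q" "q\<^sup>2"] by auto

lemma power_sums_eq:
  fixes b :: "nat \<Rightarrow> real"
  defines "b \<equiv> starlike_coeff q a"
  shows "- b 1 = s1" "(b 1)\<^sup>2 - 2 * b 2 = s2" "3 * b 1 * b 2 - b 1 ^ 3 - 3 * b 3 = s3"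
proof -
  define u where "u = 1 - q"
  define v where "v = 1 - a"
  define v1 where "v1 = 1 - a * q"
  define v2 where "v2 = 1 - a * q\<^sup>2"
  define p where "p = 1 + q"
  define p2 where "p2 = 1 + q + q\<^sup>2"
  have nz: "u \<noteq> 0" "v \<noteq> 0" "v1 \<noteq> 0" "v2 \<noteq> 0" "p \<noteq> 0" "p2 \<noteq> 0"
    using nonzero by (simp_all add: u_def v_def v1_def v2_def p_def p2_def)
  have q2: "1 - q ^ 2 = u * p" by (simp add: u_def p_def power2_eq_square algebra_simps)
  have q3: "1 - q ^ 3 = u * p2" by (simp add: u_def p2_def power2_eq_square power3_eq_cube algebra_simps)
  have b1: "b 1 = - 3 * q / (u * v)"
    using he_coeff_numeral(1) by (simp add: b_def starlike_coeff_def u_def v_def)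
  have b2: "b 2 = 5 * q ^ 3 / (u\<^sup>2 * p * v * v1)"
    unfolding b_def starlike_coeff_def he_coeff_numeral(2) q2
    by (simp add: u_def v_def v1_def power2_eq_square mult_ac)
  have b3: "b 3 = - 7 * q ^ 6 / (u ^ 3 * p * p2 * v * v1 * v2)"
    unfolding b_def starlike_coeff_def he_coeff_numeral(3) q2 q3
    by (simp add: u_def v_def v1_def v2_def power3_eq_cube mult_ac)
  show "- b 1 = s1" unfolding b1 s1_def u_def v_def by simp
  have "(b 1)\<^sup>2 - 2 * b 2 = q\<^sup>2 * (9 * v1 * p - 10 * q * v) / (v\<^sup>2 * u\<^sup>2 * v1 * p)"
    unfolding b1 b2 using nz by (simp add: field_simps power2_eq_square power3_eq_cube)
  also have "9 * v1 * p - 10 * q * v = \<Delta>"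
    by (simp add: v1_def p_def v_def \<Delta>_def power2_eq_square algebra_simps)
  finally show "(b 1)\<^sup>2 - 2 * b 2 = s2"
    by (simp add: s2_def u_def v_def v1_def p_def)
  have "3 * b 1 * b 2 = q ^ 3 * (- 45 * q * v * v2 * p2) / (u ^ 3 * v ^ 3 * v1 * v2 * p * p2)"
    unfolding b1 b2 using nz by (simp add: divide_simps) (simp add: power2_eq_square power3_eq_cube)
  moreover have "b 1 ^ 3 = q ^ 3 * (- 27 * v1 * v2 * p * p2) / (u ^ 3 * v ^ 3 * v1 * v2 * p * p2)"
    unfolding b1 using nz by (simp add: divide_simps power_mult_distrib)
  moreover have "3 * b 3 = q ^ 3 * (- 21 * q ^ 3 * v\<^sup>2) / (u ^ 3 * v ^ 3 * v1 * v2 * p * p2)"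
    unfolding b3 using nz by (simp add: divide_simps) (simp add: eval_nat_numeral)
  ultimately have "3 * b 1 * b 2 - b 1 ^ 3 - 3 * b 3
    = q ^ 3 * (- 45 * q * v * v2 * p2 + 27 * v1 * v2 * p * p2 + 21 * q ^ 3 * v\<^sup>2) / (u ^ 3 * v ^ 3 * v1 * v2 * p * p2)"
    by (simp add: diff_divide_distrib add_divide_distrib algebra_simps)
  also have "- 45 * q * v * v2 * p2 + 27 * v1 * v2 * p * p2 + 21 * q ^ 3 * v\<^sup>2 = 3 * T"
    unfolding v_def v1_def v2_def p_def p2_def T_def
    by (simp add: algebra_simps eval_nat_numeral)
  finally show "3 * b 1 * b 2 - b 1 ^ 3 - 3 * b 3 = s3"
    by (simp add: s3_def u_def v_def v1_def v2_def p_def p2_def mult_ac)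
qed

lemma first_zero:
  obtains w where "0 < w" "starlike_fun w = (0 :: real)"
    "\<forall>v\<in>{0..<w}. 0 < (starlike_fun v :: real)"
    "\<forall>z :: complex. z \<noteq> 0 \<and> norm z < w \<longrightarrow> 0 < Re (starlike_fun z / he_fun z)"
    "0 < s1" "0 < s2" "0 < s3"
    "1 < s1 * w" "s2 * w < s1" "1 < s2 * w\<^sup>2" "s3 * w < s2"
proof -
  obtain tF tH where "real_rooted_limit (he_coeff q a) tF" "real_rooted_limit (starlike_coeff q a) tH"
    by (rule real_rooted_limits)
  then interpret F: real_rooted_limit "he_coeff q a" tF + H: real_rooted_limit "starlike_coeff q a" tH
    by simp_all
  have F_B: "F.B v = he_fun v" for v by (simp add: F.B_def he_fun_def)
  have H_B: "H.B v = starlike_fun v" for v by (simp add: H.B_def starlike_fun_def)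
  obtain w where w: "0 < w" "H.B w = 0" "\<forall>v\<in>{0..<w}. 0 < H.B v"
    "0 < H.\<sigma> 0" "0 < H.\<sigma> 1" "0 < H.\<sigma> 2"
    "1 < H.\<sigma> 0 * w" "H.\<sigma> 1 * w < H.\<sigma> 0" "1 < H.\<sigma> 1 * w\<^sup>2" "H.\<sigma> 2 * w < H.\<sigma> 1"
    by (rule H.euler_rayleigh[OF starlike_coeff_nonzero starlike_coeff_ratio_tendsto])
  have \<sigma>: "H.\<sigma> 0 = s1" "H.\<sigma> 1 = s2" "H.\<sigma> 2 = s3"
    unfolding H.\<sigma>_0 H.\<sigma>_1 H.\<sigma>_2 by (rule power_sums_eq)+
  have F_pos: "0 < F.B v" if v: "0 \<le> v" "v < w" for v
  proof (cases "v = 0")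
    case False
    have F_der: "\<exists>D. (F.B has_real_derivative D) (at x) \<and> F.B x + 2 * x * D = H.B x" for x
    proof -
      obtain D where "(he_fun has_real_derivative D) (at x)" "2 * x * D = starlike_fun x - he_fun x"
        by (rule he_fun_has_derivative)
      moreover have "F.B = he_fun" by (rule ext) (rule F_B)
      ultimately show ?thesis by (auto simp: H_B)
    qed
    have "sqrt 0 * F.B 0 < sqrt v * F.B v"
    proof (rule DERIV_pos_imp_increasing_open[where f = "\<lambda>x. sqrt x * F.B x" and a = 0 and b = v])
      show "0 < v" using False v by simp
      fix x assume x: "0 < x" "x < v"
      obtain D where D: "(F.B has_real_derivative D) (at x)" "F.B x + 2 * x * D = H.B x"
        using F_der by blast
      have "((\<lambda>x. sqrt x * F.B x) has_real_derivative inverse (sqrt x) / 2 * F.B x + D * sqrt x) (at x)"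
        by (rule DERIV_mult[OF DERIV_real_sqrt[OF x(1)] D(1)])
      moreover have "inverse (sqrt x) / 2 * F.B x + D * sqrt x = inverse (sqrt x) / 2 * H.B x"
        using x unfolding D(2)[symmetric] by (simp add: field_simps)
      moreover have "0 < inverse (sqrt x) / 2 * H.B x" using w(3) x v by auto
      ultimately show "\<exists>y. ((\<lambda>x. sqrt x * F.B x) has_real_derivative y) (at x) \<and> 0 < y" by auto
    next
      show "continuous_on {0..v} (\<lambda>x. sqrt x * F.B x)"
        by (intro continuous_intros continuous_at_imp_continuous_on ballI F.isCont_B)
    qed
    then show ?thesis using False v by (simp add: zero_less_mult_iff)
  qed (simp add: F.B_0)
  have Re_pos: "0 < Re (starlike_fun z / he_fun z)" if z: "z \<noteq> 0" "norm z < w" for z :: complex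
  proof -
    have "H.B (norm z) / F.B (norm z) \<le> Re (starlike_fun z / he_fun z)"
      using F.Re_log_deriv_ge[OF summable_starlike_coeff[unfolded starlike_coeff_def] z(1)] F_pos z(2)
      unfolding H.B_def starlike_fun_def he_fun_def starlike_coeff_def by auto
    moreover have "0 < H.B (norm z) / F.B (norm z)"
      using F_pos[of "norm z"] w(3) z(2) by auto
    ultimately show ?thesis by linarith
  qed
  show thesis
    by (rule that) (use w Re_pos F_pos in \<open>auto simp: \<sigma> F_B H_B simp del: One_nat_def\<close>)
qed

end

lemma q_powr_add_nat:
  fixes q \<nu> :: real
  assumes "0 < q"
  shows "q powr (\<nu> + 1 + real n) = q powr (\<nu> + 1) * q ^ n"
  using assms by (simp add: powr_add powr_realpow)

lemma he_term_eq:
  assumes q: "0 < q" "q < 1" and a: "0 < a" "a < 1"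
  shows "(-1) ^ n * q powr (real n * (real n + 1) / 2) / (qpoch q q n * qpoch a q n) = he_coeff q a n"
proof (induction n)
  case 0
  then show ?case using q by (simp add: he_coeff_def qpoch_def)
next
  case (Suc n)
  have "real (Suc n) * (real (Suc n) + 1) / 2 = real n * (real n + 1) / 2 + real (Suc n)"
    by (simp add: field_simps)
  then have "q powr (real (Suc n) * (real (Suc n) + 1) / 2) = q powr (real n * (real n + 1) / 2) * q ^ Suc n"
    using q by (simp only: powr_add powr_realpow)
  moreover have "he_coeff q a (Suc n) = he_coeff q a n * (- (q ^ Suc n) / ((1 - q ^ Suc n) * (1 - a * q ^ n)))"
    by (simp only: he_coeff_def prod.lessThan_Suc)
  ultimately show ?case
    unfolding Suc[symmetric] by (simp add: qpoch_def mult_ac)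
qed

lemma powr_q_shift:
  fixes q \<nu> :: real
  assumes "0 < q"
  shows "q powr (\<nu> + 2) = q powr (\<nu> + 1) * q"
    "q powr (\<nu> + 3) = q powr (\<nu> + 1) * q ^ 2"
    "q powr (\<nu> + 4) = q powr (\<nu> + 1) * q ^ 3"
    "q powr (\<nu> + 5) = q powr (\<nu> + 1) * q ^ 4"
    "q powr (\<nu> + 6) = q powr (\<nu> + 1) * q ^ 5"
    "q powr (2 * \<nu> + 5) = (q powr (\<nu> + 1))\<^sup>2 * q ^ 3"
    "q powr (2 * \<nu> + 6) = (q powr (\<nu> + 1))\<^sup>2 * q ^ 4"
    "q powr (2 * \<nu> + 7) = (q powr (\<nu> + 1))\<^sup>2 * q ^ 5"
    "q powr (2 * \<nu> + 8) = (q powr (\<nu> + 1))\<^sup>2 * q ^ 6"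
proof -
  have 1: "q powr (\<nu> + 1 + real n) = q powr (\<nu> + 1) * q ^ n" for n
    using assms by (rule q_powr_add_nat)
  have 2: "q powr ((\<nu> + 1) + (\<nu> + 1) + real n) = (q powr (\<nu> + 1))\<^sup>2 * q ^ n" for n
    unfolding powr_add[of q "\<nu> + 1 + (\<nu> + 1)"] powr_add[of q "\<nu> + 1" "\<nu> + 1"]
    using assms by (simp only: powr_realpow power2_eq_square)
  show "q powr (\<nu> + 2) = q powr (\<nu> + 1) * q"
    "q powr (\<nu> + 3) = q powr (\<nu> + 1) * q ^ 2"
    "q powr (\<nu> + 4) = q powr (\<nu> + 1) * q ^ 3"
    "q powr (\<nu> + 5) = q powr (\<nu> + 1) * q ^ 4"
    "q powr (\<nu> + 6) = q powr (\<nu> + 1) * q ^ 5"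
    using 1[of 1] 1[of 2] 1[of 3] 1[of 4] 1[of 5] by (simp_all add: add.assoc)
  show "q powr (2 * \<nu> + 5) = (q powr (\<nu> + 1))\<^sup>2 * q ^ 3"
    "q powr (2 * \<nu> + 6) = (q powr (\<nu> + 1))\<^sup>2 * q ^ 4"
    "q powr (2 * \<nu> + 7) = (q powr (\<nu> + 1))\<^sup>2 * q ^ 5"
    "q powr (2 * \<nu> + 8) = (q powr (\<nu> + 1))\<^sup>2 * q ^ 6"
    using 2[of 3] 2[of 4] 2[of 5] 2[of 6] by (simp_all add: algebra_simps)
qed

locale hahn_exton_nu = hahn_exton q "q powr (\<nu> + 1)" for q \<nu> :: real
begin

abbreviation (input) a where "a \<equiv> q powr (\<nu> + 1)"

lemma qpoch_inf_nonzero: "qpoch_inf q q \<noteq> 0" "qpoch_inf a q \<noteq> 0"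
  using prodinf_q_pochhammer_nonzero[OF q q] prodinf_q_pochhammer_nonzero[OF q a] by simp_all

lemma g3_eq: "g3 \<nu> q z = z * he_fun (z\<^sup>2)"
proof -
  have "(-1) ^ n * z ^ (2 * n + 1) * complex_of_real (q powr (real n * (real n + 1) / 2))
        / complex_of_real (qpoch q q n * qpoch a q n)
      = z * (complex_of_real (he_coeff q a n) * (z\<^sup>2) ^ n)" for n
    unfolding he_term_eq[OF q a, symmetric] by (simp add: power_mult)
  moreover have "complex_of_real (c_nu \<nu> q) * complex_of_real (qpoch_inf a q / qpoch_inf q q) = 1"
    using qpoch_inf_nonzero unfolding c_nu_def of_real_mult[symmetric] by simp
  ultimately show ?thesis
    unfolding g3_def he_fun_def by (simp only: mult_1 suminf_mult[OF summable_he])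
qed

lemma deriv_g3: "deriv (g3 \<nu> q) z = starlike_fun (z\<^sup>2)"
proof (rule DERIV_imp_deriv)
  obtain D where D: "(he_fun has_field_derivative D) (at (z\<^sup>2))"
    "2 * z\<^sup>2 * D = starlike_fun (z\<^sup>2) - he_fun (z\<^sup>2)"
    by (rule he_fun_has_derivative)
  have "((\<lambda>z. he_fun (z\<^sup>2)) has_field_derivative D * (2 * z)) (at z)"
    by (rule DERIV_chain2[where f = he_fun]) (rule D(1), auto intro!: derivative_eq_intros)
  from DERIV_mult[OF DERIV_ident this]
  have "((\<lambda>z. z * he_fun (z\<^sup>2)) has_field_derivative 1 * he_fun (z\<^sup>2) + D * (2 * z) * z) (at z)" .
  moreover have "1 * he_fun (z\<^sup>2) + D * (2 * z) * z = starlike_fun (z\<^sup>2)"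
    using D(2) by (simp add: power2_eq_square algebra_simps)
  moreover have "g3 \<nu> q = (\<lambda>z. z * he_fun (z\<^sup>2))"
    by (rule ext) (rule g3_eq)
  ultimately show "(g3 \<nu> q has_field_derivative starlike_fun (z\<^sup>2)) (at z)" by simp
qed

lemma J3_eq:
  assumes "0 < r"
  shows "J3 \<nu> q r = qpoch_inf a q / qpoch_inf q q * (r powr \<nu> * he_fun (r\<^sup>2))"
proof -
  have "(-1) ^ n * r powr (2 * real n + \<nu>) * q powr (real n * (real n + 1) / 2)
        / (qpoch q q n * qpoch a q n)
      = r powr \<nu> * (of_real (he_coeff q a n) * (r\<^sup>2) ^ n)" for n
  proof -
    have "r powr (2 * real n + \<nu>) = r powr \<nu> * (r\<^sup>2) ^ n"
      using assms powr_realpow[of r "2 * n"] by (simp add: powr_add power_mult)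
    then show ?thesis
      unfolding he_term_eq[OF q a, symmetric] by simp
  qed
  then show ?thesis
    unfolding J3_def he_fun_def by (simp only: suminf_mult[OF summable_he])
qed

lemma J3_equation:
  assumes r: "0 < r"
  shows "r * deriv (J3 \<nu> q) r - (\<nu> - 1) * J3 \<nu> q r
    = qpoch_inf a q / qpoch_inf q q * r powr \<nu> * starlike_fun (r\<^sup>2)"
proof -
  define K where "K = qpoch_inf a q / qpoch_inf q q"
  obtain D where D: "(he_fun has_field_derivative D) (at (r\<^sup>2))"
    "2 * r\<^sup>2 * D = starlike_fun (r\<^sup>2) - he_fun (r\<^sup>2)"
    by (rule he_fun_has_derivative)
  have "((\<lambda>r. he_fun (r\<^sup>2)) has_field_derivative D * (2 * r)) (at r)"
    by (rule DERIV_chain2[where f = he_fun]) (rule D(1), auto intro!: derivative_eq_intros)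
  from DERIV_cmult[OF DERIV_mult[OF has_real_derivative_powr[OF r] this], of K \<nu>]
  have "((\<lambda>r. K * (r powr \<nu> * he_fun (r\<^sup>2))) has_field_derivative
      K * (\<nu> * r powr (\<nu> - 1) * he_fun (r\<^sup>2) + D * (2 * r) * r powr \<nu>)) (at r)" .
  moreover have "\<forall>\<^sub>F x in nhds r. J3 \<nu> q x = K * (x powr \<nu> * he_fun (x\<^sup>2))"
    using eventually_nhds_in_open[of "{0<..}" r] r
    by (auto elim!: eventually_mono simp: J3_eq K_def)
  ultimately have "(J3 \<nu> q has_field_derivative
      K * (\<nu> * r powr (\<nu> - 1) * he_fun (r\<^sup>2) + D * (2 * r) * r powr \<nu>)) (at r)"
    by (subst DERIV_cong_ev[OF refl _ refl])
  then have d: "deriv (J3 \<nu> q) r = K * (\<nu> * r powr (\<nu> - 1) * he_fun (r\<^sup>2) + D * (2 * r) * r powr \<nu>)"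
    by (rule DERIV_imp_deriv)
  have p: "r powr (\<nu> - 1) = r powr \<nu> / r"
    using r by (simp add: powr_diff)
  have "r * deriv (J3 \<nu> q) r - (\<nu> - 1) * J3 \<nu> q r
      = K * r powr \<nu> * (he_fun (r\<^sup>2) + 2 * r\<^sup>2 * D)"
    unfolding d p J3_eq[OF r] K_def[symmetric] using r
    by (simp add: power2_eq_square algebra_simps)
  then show ?thesis unfolding D(2) K_def by simp
qed

text \<open>The radius cannot exceed \<open>sqrt w\<close> because the quotient is \<open>0\<close> at \<open>sqrt w\<close>, whether or not
  \<open>g3\<close> vanishes there (\<open>0 / 0 = 0\<close>).\<close>
lemma radius_starlike_g3:
  assumes w: "0 < w" "starlike_fun w = (0 :: real)"
    and pos: "\<forall>z :: complex. z \<noteq> 0 \<and> norm z < w \<longrightarrow> 0 < Re (starlike_fun z / he_fun z)"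
  shows "radius_starlike (g3 \<nu> q) = sqrt w"
  unfolding radius_starlike_def
proof (rule cSup_eq_maximum)
  have quot: "z * deriv (g3 \<nu> q) z / g3 \<nu> q z = starlike_fun (z\<^sup>2) / he_fun (z\<^sup>2)" if "z \<noteq> 0" for z
    using that by (simp add: deriv_g3 g3_eq)
  have "0 < Re (z * deriv (g3 \<nu> q) z / g3 \<nu> q z)" if z: "0 < norm z" "norm z < sqrt w" for z
  proof -
    have "norm (z\<^sup>2) < w"
      using z(2) w(1) by (metis norm_ge_zero norm_power real_less_rsqrt real_sqrt_less_iff real_sqrt_unique)
    moreover have "z \<noteq> 0" using z by auto
    ultimately show ?thesis using pos by (simp add: quot)
  qed
  then show "sqrt w \<in> {r. r > 0 \<and> (\<forall>z. 0 < norm z \<and> norm z < r \<longrightarrow>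
      Re (z * deriv (g3 \<nu> q) z / g3 \<nu> q z) > 0)}"
    using w(1) by simp
  fix r assume r: "r \<in> {r. r > 0 \<and> (\<forall>z. 0 < norm z \<and> norm z < r \<longrightarrow>
      Re (z * deriv (g3 \<nu> q) z / g3 \<nu> q z) > 0)}"
  show "r \<le> sqrt w"
  proof (rule ccontr)
    assume "\<not> r \<le> sqrt w"
    then have "0 < Re (of_real (sqrt w) * deriv (g3 \<nu> q) (of_real (sqrt w)) / g3 \<nu> q (of_real (sqrt w)))"
      using r w(1) by (auto simp: norm_of_real)
    moreover have "starlike_fun ((complex_of_real (sqrt w))\<^sup>2) = of_real (starlike_fun w)"
    proof -
      have "(complex_of_real (sqrt w))\<^sup>2 = of_real w"
        using w(1) by (simp flip: of_real_power)
      moreover have "(\<Sum>n. complex_of_real (starlike_coeff q a n) * of_real w ^ n)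
          = of_real (\<Sum>n. starlike_coeff q a n * w ^ n)"
        unfolding of_real_power[symmetric] of_real_mult[symmetric]
        by (rule suminf_of_real[symmetric])
          (use summable_starlike_coeff[of "\<bar>w\<bar>"] in \<open>auto intro!: summable_norm_cancel[of "\<lambda>n. starlike_coeff q a n * w ^ n"] simp: abs_mult power_abs\<close>)
      ultimately show ?thesis by (simp add: starlike_fun_def)
    qed
    ultimately show False using w(2) by (simp add: deriv_g3)
  qed
qed

end

context hahn_exton
begin

lemma bounds_eq:
  assumes "s2 \<noteq> 0" "s3 \<noteq> 0"
  shows "(1 - q) * (1 - a) / (3 * q) = 1 / s1"
    "3 * (a - 1) * (a * q - 1) * (q\<^sup>2 - 1) / (q * (9 * (a * q ^ 2) - a * q + q - 9)) = s1 / s2"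
    "(a - 1)\<^sup>2 * (q - 1)\<^sup>2 * (a * q - 1) * (q + 1) / (q\<^sup>2 * (9 * (a * q ^ 2) - a * q + q - 9)) = 1 / s2"
    "(q - 1) * (a - 1) * (a * q ^ 2 - 1) / (3 * q * (q + 1))
      * ((9 * (a * q ^ 2) - a * q + q - 9) * (q ^ 3 + 2 * q\<^sup>2 + 2 * q + 1) / T) = s2 / s3"
proof -
  define u where "u = 1 - q"
  define v where "v = 1 - a"
  define v1 where "v1 = 1 - a * q"
  define v2 where "v2 = 1 - a * q\<^sup>2"
  define p where "p = 1 + q"
  define p2 where "p2 = 1 + q + q\<^sup>2"
  have nz: "u \<noteq> 0" "v \<noteq> 0" "v1 \<noteq> 0" "v2 \<noteq> 0" "p \<noteq> 0" "p2 \<noteq> 0" "q \<noteq> 0" "\<Delta> \<noteq> 0" "T \<noteq> 0"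
    using nonzero q assms by (auto simp: u_def v_def v1_def v2_def p_def p2_def s2_def s3_def)
  have s: "s1 = 3 * q / (u * v)" "s2 = q\<^sup>2 * \<Delta> / (v\<^sup>2 * u\<^sup>2 * v1 * p)"
    "s3 = 3 * q ^ 3 * T / (u ^ 3 * v ^ 3 * v1 * v2 * p * p2)"
    by (simp_all only: s1_def s2_def s3_def u_def v_def v1_def v2_def p_def p2_def)
  have eqs: "1 - q = u" "1 - a = v" "q - 1 = - u" "a - 1 = - v" "a * q - 1 = - v1" "a * q\<^sup>2 - 1 = - v2"
    "q\<^sup>2 - 1 = - (u * p)" "q + 1 = p" "q ^ 3 + 2 * q\<^sup>2 + 2 * q + 1 = p * p2"
    "9 * (a * q\<^sup>2) - a * q + q - 9 = - \<Delta>"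
    by (simp_all add: u_def v_def v1_def v2_def p_def p2_def \<Delta>_def power2_eq_square power3_eq_cube algebra_simps)
  show "(1 - q) * (1 - a) / (3 * q) = 1 / s1"
    unfolding eqs s by simp
  show "3 * (a - 1) * (a * q - 1) * (q\<^sup>2 - 1) / (q * (9 * (a * q ^ 2) - a * q + q - 9)) = s1 / s2"
    unfolding eqs s using nz by (simp add: field_simps power2_eq_square)
  show "(a - 1)\<^sup>2 * (q - 1)\<^sup>2 * (a * q - 1) * (q + 1) / (q\<^sup>2 * (9 * (a * q ^ 2) - a * q + q - 9)) = 1 / s2"
    unfolding eqs s using nz by (simp add: field_simps)
  show "(q - 1) * (a - 1) * (a * q ^ 2 - 1) / (3 * q * (q + 1))
      * ((9 * (a * q ^ 2) - a * q + q - 9) * (q ^ 3 + 2 * q\<^sup>2 + 2 * q + 1) / T) = s2 / s3"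
    unfolding eqs s using nz by (simp add: field_simps power2_eq_square power3_eq_cube)
qed

end

theorem theorem5:
  fixes q \<nu> :: real
  assumes "0 < q" "q < 1" "\<nu> > -1"
  defines "rs \<equiv> radius_starlike (g3 \<nu> q)"
  shows "rs > 0
    \<and> rs * deriv (J3 \<nu> q) rs - (\<nu> - 1) * J3 \<nu> q rs = 0
    \<and> (\<forall>r. 0 < r \<and> r < rs \<longrightarrow> r * deriv (J3 \<nu> q) r - (\<nu> - 1) * J3 \<nu> q r \<noteq> 0)
    \<and> sqrt ((1 - q) * (1 - q powr (\<nu> + 1)) / (3 * q)) < rs
    \<and> rs < sqrt (3 * (q powr (\<nu> + 1) - 1) * (q powr (\<nu> + 2) - 1) * (q^2 - 1)
              / (q * (9 * q powr (\<nu> + 3) - q powr (\<nu> + 2) + q - 9)))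
    \<and> root 4 ((q powr (\<nu> + 1) - 1)^2 * (q - 1)^2 * (q powr (\<nu> + 2) - 1) * (q + 1)
              / (q^2 * (9 * q powr (\<nu> + 3) - q powr (\<nu> + 2) + q - 9))) < rs
    \<and> rs < sqrt ((q - 1) * (q powr (\<nu> + 1) - 1) * (q powr (\<nu> + 3) - 1) / (3 * q * (q + 1))
              * ((9 * q powr (\<nu> + 3) - q powr (\<nu> + 2) + q - 9) * (q^3 + 2 * q^2 + 2 * q + 1)
                 / ((6 * q powr (\<nu> + 2) - 12 * q powr (\<nu> + 3) - 20 * q powr (\<nu> + 4)
                     - 12 * q powr (\<nu> + 5) + 6 * q powr (\<nu> + 6) + q powr (2 * \<nu> + 5))
                  + (3 * q powr (2 * \<nu> + 6) + 3 * q powr (2 * \<nu> + 7) + 9 * q powr (2 * \<nu> + 8)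
                     + q^3 + 3 * q^2 + 3 * q + 9))))"
proof -
  have "q powr (\<nu> + 1) < q powr 0"
    using assms by (intro powr_less_mono') auto
  then interpret hahn_exton_nu q \<nu>
    using assms by unfold_locales auto
  obtain w where w: "0 < w" "starlike_fun w = (0 :: real)"
    and H_pos: "\<forall>v\<in>{0..<w}. 0 < (starlike_fun v :: real)"
    and star: "\<forall>z :: complex. z \<noteq> 0 \<and> norm z < w \<longrightarrow> 0 < Re (starlike_fun z / he_fun z)"
    and s: "0 < s1" "0 < s2" "0 < s3" and ineq: "1 < s1 * w" "s2 * w < s1" "1 < s2 * w\<^sup>2" "s3 * w < s2"
    by (rule first_zero)
  have rs: "rs = sqrt w"
    unfolding rs_def by (rule radius_starlike_g3[OF w star])
  have "rs * deriv (J3 \<nu> q) rs - (\<nu> - 1) * J3 \<nu> q rs = 0"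
    using w J3_equation[of "sqrt w"] by (simp add: rs)
  moreover have "r * deriv (J3 \<nu> q) r - (\<nu> - 1) * J3 \<nu> q r \<noteq> 0" if r: "0 < r" "r < rs" for r
  proof -
    have "r\<^sup>2 < (sqrt w)\<^sup>2"
      using r by (intro power_strict_mono) (auto simp: rs)
    then have "r\<^sup>2 < w" using w(1) by simp
    then have "0 < (starlike_fun (r\<^sup>2) :: real)" using H_pos by auto
    then show ?thesis
      unfolding J3_equation[OF r(1)] using qpoch_inf_nonzero r(1) by simp
  qed
  moreover have "sqrt (1 / s1) < rs"
    using ineq(1) s(1) by (simp add: rs field_simps)
  moreover have "rs < sqrt (s1 / s2)"
    using ineq(2) s(2) by (simp add: rs field_simps)
  moreover have "root 4 (1 / s2) < rs"
  proof -
    have "root 4 (1 / s2) < root 4 (w\<^sup>2)"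
      using ineq(3) s(2) by (simp add: field_simps)
    also have "w\<^sup>2 = rs ^ 4"
      using w(1) by (simp add: rs power4_eq_xxxx power2_eq_square)
    also have "root 4 (rs ^ 4) = rs"
      using w(1) by (simp add: rs real_root_power_cancel)
    finally show ?thesis .
  qed
  moreover have "rs < sqrt (s2 / s3)"
    using ineq(4) s(3) by (simp add: rs field_simps)
  moreover have "rs > 0" using w(1) by (simp add: rs)
  ultimately show ?thesis
    unfolding powr_q_shift[OF assms(1), of \<nu>] T_def[symmetric]
      bounds_eq[OF less_imp_neq[OF s(2), symmetric] less_imp_neq[OF s(3), symmetric]]
    by blast
qed

end
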